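(* Let $X$, $Y$ be Banach spaces. Suppose that $B_Y$ is a slicely countably determined (SCD) set and that $X\hat{\otimes}_\pi Y$ has the Daugavet property. Then $X$ has the Daugavet property.
   Context: Banach spaces are (nonzero) real or complex; $X$ and $Y$ are over the same field. $B_Y$ is the closed unit ball of $Y$, $X^*$ is the topological dual of $X$, and $\mathcal{L}(X)$ is the space of bounded linear operators on $X$ with the operator norm. A Banach space $X$ has the Daugavet property if $\|\mathrm{Id}+T\|=1+\|T\|$ for every rank-one operator $T\in\mathcal{L}(X)$. The projective tensor product $X\hat{\otimes}_\pi Y$ is the completion of $X\otimes Y$ under $\|u\|_\pi=\inf\{\sum_{i=1}^n\|x_i\|\,\|y_i\| : u=\sum_{i=1}^n x_i\otimes y_i\}$. Let $A$ be a bounded subset of a Banach space. A slice of $A$ is a nonempty intersection of $A$ with an open half space, i.e. a set of the form $\{x\in A : \operatorname{Re}x^*(x)>\sup\operatorname{Re}x^*(A)-\delta\}$ with $x^*$ in the dual and $\delta>0$. A countable family $\{V_n : n\in\mathbb{N}\}$ of subsets of $A$ is determining for $A$ if $A\subseteq\overline{\operatorname{conv}}(B)$ for every subset $B\subseteq A$ intersecting all the sets $V_n$. The set $A$ is slicely countably determined (SCD) if there exists a countable family of slices of $A$ which is determining for $A$. *)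

theory Defs
  imports "HOL-Analysis.Analysis" "HOL-Library.Function_Algebras"
begin

text \<open>
  The scalar field is the real or the complex numbers. A class lets one statement cover
  both: a type of this class is isometrically isomorphic, as a field, to \<open>\<real>\<close> or to the
  complex numbers via \<open>to_complex\<close>.
\<close>

class real_or_complex = real_normed_field +
  fixes to_complex :: "'a \<Rightarrow> complex"
  assumes to_complex_add: "to_complex (a + b) = to_complex a + to_complex b"
    and to_complex_mult: "to_complex (a * b) = to_complex a * to_complex b"
    and to_complex_scaleR: "to_complex (scaleR r a) = scaleR r (to_complex a)"
    and norm_to_complex: "norm (to_complex a) = norm a"
    and range_to_complex: "range to_complex = \<real> \<or> range to_complex = UNIV"

instantiation real :: real_or_complex
begin
definition to_complex_real :: "real \<Rightarrow> complex" where "to_complex_real = of_real"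
instance
  by standard (auto simp: to_complex_real_def Reals_def scaleR_conv_of_real)
end

instantiation complex :: real_or_complex
begin
definition to_complex_complex :: "complex \<Rightarrow> complex" where "to_complex_complex = id"
instance
  by standard (auto simp: to_complex_complex_def)
end

definition re :: "'k::real_or_complex \<Rightarrow> real" where
  "re a = Re (to_complex a)"

text \<open>
  Nonzero Banach spaces over \<open>'k\<close>. The class \<open>banach\<close> provides the norm, completeness and
  the underlying real structure, with which the scalar multiplication has to agree.
\<close>

locale banach_over = vector_space scale
  for scale :: "'k::real_or_complex \<Rightarrow> 'a::banach \<Rightarrow> 'a" +
  assumes scale_of_real: "scale (of_real r) x = r *\<^sub>R x"
    and norm_scale: "norm (scale c x) = norm c * norm x"
    and nonzero: "\<exists>x::'a. x \<noteq> 0"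

definition bounded_linear_over ::
  "('k::real_or_complex \<Rightarrow> 'a::real_normed_vector \<Rightarrow> 'a) \<Rightarrow>
   ('k \<Rightarrow> 'b::real_normed_vector \<Rightarrow> 'b) \<Rightarrow> ('a \<Rightarrow> 'b) \<Rightarrow> bool" where
  "bounded_linear_over s t f \<longleftrightarrow> Vector_Spaces.linear s t f \<and> bounded_linear f"

definition Daugavet_property :: "('k::real_or_complex \<Rightarrow> 'a::banach \<Rightarrow> 'a) \<Rightarrow> bool" where
  "Daugavet_property s \<longleftrightarrow>
     (\<forall>T. bounded_linear_over s s T \<and> vector_space.dim s (range T) = 1 \<longrightarrow>
          onorm (\<lambda>x. x + T x) = 1 + onorm T)"

definition slice_of ::
  "('k::real_or_complex \<Rightarrow> 'a::banach \<Rightarrow> 'a) \<Rightarrow> 'a set \<Rightarrow> 'a set \<Rightarrow> bool" where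
  "slice_of s A S \<longleftrightarrow>
     S \<noteq> {} \<and>
     (\<exists>f \<delta>. bounded_linear_over s ((*) :: 'k \<Rightarrow> 'k \<Rightarrow> 'k) f \<and> \<delta> > 0 \<and>
        S = {x \<in> A. re (f x) > (SUP a\<in>A. re (f a)) - \<delta>})"

definition determining :: "'a::banach set \<Rightarrow> (nat \<Rightarrow> 'a set) \<Rightarrow> bool" where
  "determining A V \<longleftrightarrow>
     (\<forall>n. V n \<subseteq> A) \<and>
     (\<forall>B \<subseteq> A. (\<forall>n. B \<inter> V n \<noteq> {}) \<longrightarrow> A \<subseteq> closure (convex hull B))"

definition slicely_countably_determined ::
  "('k::real_or_complex \<Rightarrow> 'a::banach \<Rightarrow> 'a) \<Rightarrow> 'a set \<Rightarrow> bool" where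
  "slicely_countably_determined s A \<longleftrightarrow>
     bounded A \<and> (\<exists>V. (\<forall>n. slice_of s A (V n)) \<and> determining A V)"

text \<open>
  The algebraic tensor product is realised inside the space of linear functionals on the
  bilinear forms on \<open>X \<times> Y\<close>: the simple tensor of \<open>x\<close> and \<open>y\<close> is evaluation at \<open>(x, y)\<close>
  (as in Ryan, Introduction to Tensor Products of Banach Spaces). Bilinear forms are not
  required to be bounded. Functionals are extended by 0 to functions that are not bilinear
  forms, so that equality of functionals is equality in HOL.
\<close>

definition bilinear_form ::
  "('k::field \<Rightarrow> 'a::ab_group_add \<Rightarrow> 'a) \<Rightarrow> ('k \<Rightarrow> 'b::ab_group_add \<Rightarrow> 'b) \<Rightarrow>
   ('a \<Rightarrow> 'b \<Rightarrow> 'k) \<Rightarrow> bool" where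
  "bilinear_form s t \<beta> \<longleftrightarrow>
     (\<forall>y. Vector_Spaces.linear s (*) (\<lambda>x. \<beta> x y)) \<and>
     (\<forall>x. Vector_Spaces.linear t (*) (\<lambda>y. \<beta> x y))"

definition simple_tensor ::
  "('k::field \<Rightarrow> 'a::ab_group_add \<Rightarrow> 'a) \<Rightarrow> ('k \<Rightarrow> 'b::ab_group_add \<Rightarrow> 'b) \<Rightarrow>
   'a \<Rightarrow> 'b \<Rightarrow> ('a \<Rightarrow> 'b \<Rightarrow> 'k) \<Rightarrow> 'k" where
  "simple_tensor s t x y = (\<lambda>\<beta>. if bilinear_form s t \<beta> then \<beta> x y else 0)"

definition scale_functional :: "'k::field \<Rightarrow> ('c \<Rightarrow> 'k) \<Rightarrow> 'c \<Rightarrow> 'k" where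
  "scale_functional c u = (\<lambda>\<beta>. c * u \<beta>)"

definition algebraic_tensor_product ::
  "('k::field \<Rightarrow> 'a::ab_group_add \<Rightarrow> 'a) \<Rightarrow> ('k \<Rightarrow> 'b::ab_group_add \<Rightarrow> 'b) \<Rightarrow>
   (('a \<Rightarrow> 'b \<Rightarrow> 'k) \<Rightarrow> 'k) set" where
  "algebraic_tensor_product s t =
     module.span scale_functional {simple_tensor s t x y | x y. True}"

definition projective_norm ::
  "('k::field \<Rightarrow> 'a::real_normed_vector \<Rightarrow> 'a) \<Rightarrow> ('k \<Rightarrow> 'b::real_normed_vector \<Rightarrow> 'b) \<Rightarrow>
   (('a \<Rightarrow> 'b \<Rightarrow> 'k) \<Rightarrow> 'k) \<Rightarrow> real" where
  "projective_norm s t u =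
     Inf {(\<Sum>i=1..n. norm (x i) * norm (y i)) | (n::nat) x y.
            u = (\<Sum>i=1..n. simple_tensor s t (x i) (y i))}"

text \<open>
  \<open>projective_tensor_product s t r \<iota>\<close>: the Banach space with scalar multiplication \<open>r\<close>,
  together with the embedding \<open>\<iota>\<close>, is a completion of the algebraic tensor product under the
  projective norm. Completions are unique up to isometric isomorphism compatible with the
  embeddings. Only the values of \<open>\<iota>\<close> on the algebraic tensor product are relevant.
\<close>

definition projective_tensor_product ::
  "('k::real_or_complex \<Rightarrow> 'a::banach \<Rightarrow> 'a) \<Rightarrow> ('k \<Rightarrow> 'b::banach \<Rightarrow> 'b) \<Rightarrow>
   ('k \<Rightarrow> 'c::banach \<Rightarrow> 'c) \<Rightarrow> ((('a \<Rightarrow> 'b \<Rightarrow> 'k) \<Rightarrow> 'k) \<Rightarrow> 'c) \<Rightarrow> bool" where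
  "projective_tensor_product s t r \<iota> \<longleftrightarrow>
     banach_over r \<and>
     (\<forall>u \<in> algebraic_tensor_product s t. \<forall>v \<in> algebraic_tensor_product s t.
        \<iota> (u + v) = \<iota> u + \<iota> v) \<and>
     (\<forall>c. \<forall>u \<in> algebraic_tensor_product s t. \<iota> (scale_functional c u) = r c (\<iota> u)) \<and>
     (\<forall>u \<in> algebraic_tensor_product s t. norm (\<iota> u) = projective_norm s t u) \<and>
     closure (\<iota> ` algebraic_tensor_product s t) = UNIV"

end

theory Submission
  imports Defs
begin

text \<open>
  For functionals \<open>x'\<close> on \<open>X\<close> and \<open>y'\<close> on \<open>Y\<close> of norm 1, the tensor product \<open>x' \<otimes> y'\<close> is a functional
  of norm 1 on the projective tensor product \<open>Z\<close>, and simple tensors meet every nonempty cap of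
  the unit ball of \<open>Z\<close>. Hence, whatever the Daugavet property of \<open>Z\<close> says about slices, it says about simple tensors
  \<open>x \<otimes> y\<close> with \<open>x\<close> in a prescribed slice of the ball of \<open>X\<close> and \<open>y\<close> in a prescribed slice of the ball
  of \<open>Y\<close> (lemma \<open>norming_tensor_in_slices\<close>).

  To prove the Daugavet property of \<open>X\<close>, it is enough to find, for a vector \<open>x0\<close>, a slice \<open>S\<close> of the ball
  of \<open>X\<close> and \<open>e > 0\<close>, some \<open>x \<in> S\<close> with \<open>norm (x0 + x) \<ge> norm x0 + 1 - e\<close>
  (lemma \<open>Daugavet_property_if_slice_points\<close>). Let \<open>V n\<close> be a determining sequence of slices of the ball of
  \<open>Y\<close> and let \<open>norm y0 = 1\<close>. Inductively choose \<open>x n \<in> S\<close> and \<open>y n \<in> V n\<close> such that \<open>x n \<otimes> y n\<close> is almost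
  in \<open>l1\<close>-position to \<open>x0 \<otimes> y0\<close> and to the tensors chosen before; then all convex combinations satisfy
  \<open>norm (x0 \<otimes> y0 + (\<Sum>n. a n *\<^sub>R (x n \<otimes> y n))) \<ge> norm x0 + 1 - e / 2\<close>
  (lemma \<open>norming_sequence\<close>). Since the \<open>y n\<close> meet all \<open>V n\<close>, some combination \<open>\<Sum>n. a n *\<^sub>R y n\<close> is close
  to \<open>y0\<close>. For it the vector in question is close to \<open>\<Sum>n. a n *\<^sub>R ((x0 + x n) \<otimes> y n)\<close>, whose norm is at
  most the largest \<open>norm (x0 + x n)\<close>. So one of the \<open>x n\<close> is as required.

  The inductive choice needs a form of the Daugavet property that can be applied repeatedly: every
  nonempty cap of the ball of \<open>Z\<close> contains a smaller one all of whose points are norming for a given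
  compact set \<open>K\<close>, that is, satisfy \<open>norm (k + w) \<ge> norm k + 1 - e\<close> for all \<open>k \<in> K\<close> (lemma
  \<open>Daugavet_subcap_compact\<close>). The smaller cap is cut by a functional that comes from a norming
  functional, so the Hahn-Banach theorem for normed spaces is developed at the beginning; it also
  extends \<open>x' \<otimes> y'\<close> from the algebraic tensor product to its completion.
\<close>

section \<open>The Hahn-Banach theorem\<close>

definition sublinear :: "('a::real_vector \<Rightarrow> real) \<Rightarrow> bool" where
  "sublinear p \<longleftrightarrow>
     (\<forall>x y. p (x + y) \<le> p x + p y) \<and> (\<forall>c x. 0 \<le> c \<longrightarrow> p (c *\<^sub>R x) = c * p x)"

text \<open>
  Only one inequality has to be checked for positive homogeneity, because the other one follows
  by scaling back. Infima give exactly this inequality.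
\<close>

lemma sublinearI:
  assumes add: "\<And>x y. p (x + y) \<le> p x + p y"
    and zero: "p 0 = 0"
    and scale: "\<And>c x. 0 < c \<Longrightarrow> p (c *\<^sub>R x) \<le> c * p x"
  shows "sublinear p"
proof -
  have "p (c *\<^sub>R x) = c * p x" if "0 \<le> c" for c x
  proof (cases "c = 0")
    case False
    with that have c: "0 < c" by simp
    have "p x = p ((1 / c) *\<^sub>R (c *\<^sub>R x))" using c by simp
    also have "\<dots> \<le> (1 / c) * p (c *\<^sub>R x)" using c by (intro scale) simp
    finally have "c * p x \<le> p (c *\<^sub>R x)" using c by (simp add: field_simps)
    with scale[OF c, of x] show ?thesis by simp
  qed (simp add: zero)
  with add show ?thesis by (simp add: sublinear_def)
qed

lemma sublinear_add: "sublinear p \<Longrightarrow> p (x + y) \<le> p x + p y"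
  by (simp add: sublinear_def)

lemma sublinear_scaleR: "sublinear p \<Longrightarrow> 0 \<le> c \<Longrightarrow> p (c *\<^sub>R x) = c * p x"
  by (simp add: sublinear_def)

lemma sublinear_0: "sublinear p \<Longrightarrow> p 0 = 0"
  using sublinear_scaleR[of p 0 0] by simp

lemma sublinear_lower_bound: "sublinear p \<Longrightarrow> - p (- x) \<le> p x"
  using sublinear_add[of p x "- x"] sublinear_0[of p] by simp

lemma sublinear_norm: "sublinear (norm :: 'a::real_normed_vector \<Rightarrow> real)"
  by (intro sublinearI) (auto simp: norm_triangle_ineq)

text \<open>
  The infimum of \<open>p (x + u) - m u\<close> over the cone is again sublinear, and it forces every linear
  functional below it to dominate \<open>m\<close> on the cone: such a functional \<open>g\<close> satisfies
  \<open>- g u = g (- u) \<le> - m u\<close>. The inequality \<open>m \<le> p\<close> keeps the infimum finite. A cone, and not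
  only a subspace, is allowed because rays are needed as well.
\<close>

lemma sublinear_lower_on_cone:
  fixes p :: "'a::real_vector \<Rightarrow> real"
  assumes p: "sublinear p"
    and zero: "0 \<in> M" and add: "\<And>u v. u \<in> M \<Longrightarrow> v \<in> M \<Longrightarrow> u + v \<in> M"
    and scale: "\<And>c u. 0 < c \<Longrightarrow> u \<in> M \<Longrightarrow> c *\<^sub>R u \<in> M"
    and m_add: "\<And>u v. u \<in> M \<Longrightarrow> v \<in> M \<Longrightarrow> m (u + v) = m u + m v"
    and m_scale: "\<And>c u. 0 < c \<Longrightarrow> u \<in> M \<Longrightarrow> m (c *\<^sub>R u) = c * m u"
    and m_le: "\<And>u. u \<in> M \<Longrightarrow> m u \<le> p u"
  shows "\<exists>q. sublinear q \<and> (\<forall>x. q x \<le> p x) \<and> (\<forall>u\<in>M. q (- u) \<le> - m u)"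
proof -
  define q where "q x = (INF u\<in>M. p (x + u) - m u)" for x
  have m0: "m 0 = 0" using m_add[OF zero zero] by simp
  have low: "- p (- x) \<le> p (x + u) - m u" if "u \<in> M" for x u
    using m_le[OF that] sublinear_add[OF p, of "x + u" "- x"] by simp
  have bdd: "bdd_below ((\<lambda>u. p (x + u) - m u) ` M)" for x
    by (rule bdd_belowI2[of _ "- p (- x)"]) (rule low)
  have upper: "q x \<le> p (x + u) - m u" if "u \<in> M" for x u
    unfolding q_def using bdd that by (rule cINF_lower)
  have greatest: "r \<le> q x" if "\<And>u. u \<in> M \<Longrightarrow> r \<le> p (x + u) - m u" for r x
    unfolding q_def using zero that by (intro cINF_greatest) auto
  have "sublinear q"
  proof (rule sublinearI)
    fix x y
    have "q (x + y) - (p (y + v) - m v) \<le> q x" if v: "v \<in> M" for v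
    proof (rule greatest)
      fix u assume u: "u \<in> M"
      have "q (x + y) \<le> p (x + y + (u + v)) - m (u + v)" by (intro upper add u v)
      also have "\<dots> \<le> (p (x + u) + p (y + v)) - (m u + m v)"
        using sublinear_add[OF p, of "x + u" "y + v"] m_add[OF u v] by (simp add: algebra_simps)
      finally show "q (x + y) - (p (y + v) - m v) \<le> p (x + u) - m u" by simp
    qed
    then have "q (x + y) - q x \<le> q y"
      by (intro greatest) (simp add: algebra_simps)
    then show "q (x + y) \<le> q x + q y" by simp
  next
    have "q 0 \<le> 0" using upper[OF zero, of 0] by (simp add: m0 sublinear_0[OF p])
    moreover have "0 \<le> q 0" using low[of _ 0] by (intro greatest) (auto simp: sublinear_0[OF p])
    ultimately show "q 0 = 0" by simp
  next
    fix c :: real and x assume c: "0 < c"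
    have "q (c *\<^sub>R x) / c \<le> q x"
    proof (rule greatest)
      fix u assume u: "u \<in> M"
      have "q (c *\<^sub>R x) \<le> p (c *\<^sub>R x + c *\<^sub>R u) - m (c *\<^sub>R u)" by (intro upper scale c u)
      also have "\<dots> = c * (p (x + u) - m u)"
        using sublinear_scaleR[OF p, of c "x + u"] c m_scale[OF c u] by (simp add: algebra_simps)
      finally show "q (c *\<^sub>R x) / c \<le> p (x + u) - m u" using c by (simp add: field_simps)
    qed
    then show "q (c *\<^sub>R x) \<le> c * q x" using c by (simp add: field_simps)
  qed
  moreover have "q x \<le> p x" for x using upper[OF zero, of x] m0 by simp
  moreover have "q (- u) \<le> - m u" if "u \<in> M" for u
    using upper[OF that, of "- u"] sublinear_0[OF p] by simp
  ultimately show ?thesis by blast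
qed

text \<open>
  On a ray \<open>p\<close> itself is additive, so it may serve as the prescribed functional.
\<close>

lemma sublinear_lower_on_ray:
  fixes p :: "'a::real_vector \<Rightarrow> real"
  assumes p: "sublinear p"
  shows "\<exists>q. sublinear q \<and> (\<forall>x. q x \<le> p x) \<and> q (- w) \<le> - p w"
proof -
  let ?M = "{t *\<^sub>R w | t. 0 \<le> t}"
  have "\<exists>q. sublinear q \<and> (\<forall>x. q x \<le> p x) \<and> (\<forall>u\<in>?M. q (- u) \<le> - p u)"
  proof (rule sublinear_lower_on_cone[OF p])
    show "0 \<in> ?M" by (auto intro: exI[of _ 0])
    show "u + v \<in> ?M" if "u \<in> ?M" "v \<in> ?M" for u v
      using that by (auto simp flip: scaleR_left_distrib intro: add_nonneg_nonneg)
    show "c *\<^sub>R u \<in> ?M" if "0 < c" "u \<in> ?M" for c u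
      using that by (auto intro: exI[of _ "c * t" for t])
    show "p (u + v) = p u + p v" if uv: "u \<in> ?M" "v \<in> ?M" for u v
    proof -
      obtain a b where "u = a *\<^sub>R w" "v = b *\<^sub>R w" "0 \<le> a" "0 \<le> b" using uv by blast
      then show ?thesis
        using sublinear_scaleR[OF p, of "a + b" w]
        by (simp add: sublinear_scaleR[OF p] algebra_simps)
    qed
  qed (auto simp: sublinear_scaleR[OF p])
  moreover have "w \<in> ?M" by (auto intro: exI[of _ 1])
  ultimately show ?thesis by blast
qed

text \<open>
  Subadditivity passes to the infimum because two members of a chain can be replaced by the
  smaller one.
\<close>

lemma sublinear_INF_chain:
  fixes p :: "'a::real_vector \<Rightarrow> real"
  assumes "C \<noteq> {}"
    and C: "\<And>q. q \<in> C \<Longrightarrow> sublinear q" "\<And>q x. q \<in> C \<Longrightarrow> q x \<le> p x"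
    and chain: "\<And>q r. q \<in> C \<Longrightarrow> r \<in> C \<Longrightarrow> (\<forall>x. q x \<le> r x) \<or> (\<forall>x. r x \<le> q x)"
  shows "sublinear (\<lambda>x. INF q\<in>C. q x)" and "\<And>q x. q \<in> C \<Longrightarrow> (INF q\<in>C. q x) \<le> q x"
proof -
  have bdd: "bdd_below ((\<lambda>q. q x) ` C)" for x
    using C(2)[of _ "- x"] sublinear_lower_bound[OF C(1), of _ x]
    by (intro bdd_belowI2[of _ "- p (- x)"]) fastforce
  show lower: "(INF q\<in>C. q x) \<le> q x" if "q \<in> C" for q x
    using bdd that by (rule cINF_lower)
  show "sublinear (\<lambda>x. INF q\<in>C. q x)"
  proof (rule sublinearI)
    fix x y
    have "(INF q\<in>C. q (x + y)) - r y \<le> (INF q\<in>C. q x)" if r: "r \<in> C" for r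
    proof (rule cINF_greatest[OF \<open>C \<noteq> {}\<close>])
      fix q assume q: "q \<in> C"
      from chain[OF q r] obtain s where s: "s \<in> C" "s x \<le> q x" "s y \<le> r y"
        using q r by auto
      have "(INF q\<in>C. q (x + y)) \<le> s (x + y)" by (rule lower[OF s(1)])
      also have "\<dots> \<le> s x + s y" by (rule sublinear_add[OF C(1)[OF s(1)]])
      finally show "(INF q\<in>C. q (x + y)) - r y \<le> q x" using s by simp
    qed
    then have "(INF q\<in>C. q (x + y)) - (INF q\<in>C. q x) \<le> (INF q\<in>C. q y)"
      by (intro cINF_greatest[OF \<open>C \<noteq> {}\<close>]) (simp add: algebra_simps)
    then show "(INF q\<in>C. q (x + y)) \<le> (INF q\<in>C. q x) + (INF q\<in>C. q y)" by simp
  next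
    have "(INF q\<in>C. q 0) = (INF q\<in>C. 0)" by (rule INF_cong) (auto intro: sublinear_0 C(1))
    then show "(INF q\<in>C. q 0) = 0" using \<open>C \<noteq> {}\<close> by simp
  next
    fix c :: real and x assume c: "0 < c"
    have "(INF q\<in>C. q (c *\<^sub>R x)) / c \<le> (INF q\<in>C. q x)"
    proof (rule cINF_greatest[OF \<open>C \<noteq> {}\<close>])
      fix q assume q: "q \<in> C"
      show "(INF q\<in>C. q (c *\<^sub>R x)) / c \<le> q x"
        using lower[OF q, of "c *\<^sub>R x"] sublinear_scaleR[OF C(1)[OF q], of c x] c
        by (simp add: field_simps)
    qed
    then show "(INF q\<in>C. q (c *\<^sub>R x)) \<le> c * (INF q\<in>C. q x)" using c by (simp add: field_simps)
  qed
qed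

text \<open>
  A minimal sublinear functional \<open>g\<close> is linear: if it were not odd at \<open>w\<close>, the functional obtained
  from it on the ray of \<open>w\<close> would be strictly smaller, and an odd subadditive functional is
  additive. Minimal functionals exist by Zorn's lemma.
\<close>

lemma linear_below_sublinear:
  fixes p :: "'a::real_vector \<Rightarrow> real"
  assumes p: "sublinear p"
  shows "\<exists>g. linear g \<and> (\<forall>x. g x \<le> p x)"
proof -
  define A where "A = {q. sublinear q \<and> (\<forall>x. q x \<le> p x)}"
  define P where "P q r \<longleftrightarrow> (\<forall>x. r x \<le> q x)" for q r :: "'a \<Rightarrow> real"
  have "\<exists>m\<in>A. \<forall>a\<in>A. P m a \<longrightarrow> a = m"
  proof (rule predicate_Zorn)
    show "partial_order_on A (relation_of P A)"
      by (rule partial_order_on_relation_ofI) (auto simp: P_def fun_eq_iff intro: order_trans antisym)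
    fix C assume C: "C \<in> Chains (relation_of P A)"
    show "\<exists>u\<in>A. \<forall>a\<in>C. P a u"
    proof (cases "C = {}")
      case True
      then show ?thesis using p by (auto simp: A_def)
    next
      case False
      have sub: "sublinear q" "\<And>x. q x \<le> p x" if "q \<in> C" for q
        using C that by (auto simp: Chains_def relation_of_def A_def)
      have ch: "(\<forall>x. q x \<le> r x) \<or> (\<forall>x. r x \<le> q x)" if "q \<in> C" "r \<in> C" for q r
        using C that by (auto simp: Chains_def relation_of_def P_def)
      have inf: "sublinear (\<lambda>x. INF q\<in>C. q x)" "\<And>q x. q \<in> C \<Longrightarrow> (INF q\<in>C. q x) \<le> q x"
        using sublinear_INF_chain[of C p] False sub ch by blast+
      obtain q where "q \<in> C" using False by blast
      then have "(INF q\<in>C. q x) \<le> p x" for x using inf(2) sub(2) order_trans by blast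
      then have "(\<lambda>x. INF q\<in>C. q x) \<in> A" using inf(1) by (simp add: A_def)
      moreover have "\<forall>a\<in>C. P a (\<lambda>x. INF q\<in>C. q x)" using inf(2) unfolding P_def by blast
      ultimately show ?thesis by blast
    qed
  qed
  then obtain g where g: "g \<in> A" and min: "\<And>q. q \<in> A \<Longrightarrow> (\<forall>x. q x \<le> g x) \<Longrightarrow> q = g"
    by (auto simp: P_def)
  have sg: "sublinear g" and gp: "\<And>x. g x \<le> p x" using g by (auto simp: A_def)
  have minus: "g (- w) = - g w" for w
  proof -
    obtain q where q: "sublinear q" "\<And>x. q x \<le> g x" "q (- w) \<le> - g w"
      using sublinear_lower_on_ray[OF sg] by blast
    have "q \<in> A" using q(1,2) gp order_trans unfolding A_def by blast
    then have "q = g" using q(2) by (intro min) auto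
    with q(3) have "g (- w) \<le> - g w" by simp
    with sublinear_lower_bound[OF sg, of "w"] show ?thesis by simp
  qed
  have "g (x + y) = g x + g y" for x y
    using sublinear_add[OF sg, of x y] sublinear_add[OF sg, of "- x" "- y"] minus[of "x + y"]
      minus[of x] minus[of y] by simp
  moreover have "g (c *\<^sub>R x) = c * g x" for c x
  proof (cases "0 \<le> c")
    case False
    then have "g ((- c) *\<^sub>R x) = - c * g x" by (intro sublinear_scaleR[OF sg]) simp
    then show ?thesis using minus[of "c *\<^sub>R x"] by simp
  qed (rule sublinear_scaleR[OF sg])
  ultimately have "linear g" by (intro linearI) auto
  with gp show ?thesis by blast
qed

lemma Hahn_Banach:
  fixes f :: "'a::real_normed_vector \<Rightarrow> real"
  assumes M: "subspace M"
    and add: "\<And>u v. u \<in> M \<Longrightarrow> v \<in> M \<Longrightarrow> f (u + v) = f u + f v"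
    and scale: "\<And>c u. u \<in> M \<Longrightarrow> f (c *\<^sub>R u) = c * f u"
    and le: "\<And>u. u \<in> M \<Longrightarrow> f u \<le> norm u"
  shows "\<exists>g. linear g \<and> (\<forall>x. g x \<le> norm x) \<and> (\<forall>u\<in>M. g u = f u)"
proof -
  have "\<exists>q. sublinear q \<and> (\<forall>x. q x \<le> norm x) \<and> (\<forall>u\<in>M. q (- u) \<le> - f u)"
    by (rule sublinear_lower_on_cone[OF sublinear_norm])
      (use M add scale le in \<open>auto simp: subspace_def\<close>)
  then obtain q where q: "sublinear q" "\<And>x. q x \<le> norm x" "\<And>u. u \<in> M \<Longrightarrow> q (- u) \<le> - f u"
    by blast
  obtain g where g: "linear g" "\<And>x. g x \<le> q x" using linear_below_sublinear[OF q(1)] by blast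
  have ge: "f u \<le> g u" if "u \<in> M" for u
    using q(3)[OF that] g(2)[of "- u"] by (simp add: linear_neg[OF g(1)])
  have "g u = f u" if u: "u \<in> M" for u
    using ge[OF u] ge[OF subspace_neg[OF M u]] scale[OF u, of "- 1"]
    by (simp add: linear_neg[OF g(1)])
  moreover have "g x \<le> norm x" for x using g(2) q(2) by (rule order_trans)
  ultimately show ?thesis using g(1) by blast
qed

text \<open>
  The Hahn-Banach functional of a single vector. Lowering the norm along the ray of \<open>w\<close> makes
  every linear functional below it take the full value \<open>norm w\<close>.
\<close>

lemma norming_functional:
  fixes w :: "'a::real_normed_vector"
  shows "\<exists>g. linear g \<and> (\<forall>x. g x \<le> norm x) \<and> g w = norm w"
proof -
  obtain q where q: "sublinear q" "\<And>x. q x \<le> norm x" "q (- w) \<le> - norm w"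
    using sublinear_lower_on_ray[OF sublinear_norm] by blast
  obtain g where g: "linear g" "\<And>x. g x \<le> q x" using linear_below_sublinear[OF q(1)] by blast
  have "norm w \<le> g w" using q(3) g(2)[of "- w"] by (simp add: linear_neg[OF g(1)])
  moreover have le: "g x \<le> norm x" for x using g(2) q(2) by (rule order_trans)
  ultimately have "g w = norm w" using le[of w] by simp
  with g(1) le show ?thesis by blast
qed

section \<open>The scalar field\<close>

lemma to_complex_1: "to_complex (1::'k::real_or_complex) = 1"
proof -
  have "to_complex (1::'k) * to_complex (1::'k) = to_complex (1 * 1 :: 'k)"
    by (rule to_complex_mult[symmetric])
  moreover have "to_complex (1::'k) \<noteq> 0" using norm_to_complex[of "1::'k"] by auto
  ultimately show ?thesis by simp
qed

lemma to_complex_of_real: "to_complex (of_real r :: 'k::real_or_complex) = of_real r"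
  by (simp add: of_real_def to_complex_scaleR to_complex_1)

lemma re_add: "re (a + b) = re a + re b"
  by (simp add: re_def to_complex_add)

lemma re_of_real_mult: "re (of_real r * a) = r * re a"
  by (simp add: re_def to_complex_mult to_complex_of_real)

lemma re_mult_of_real: "re (a * of_real r) = re a * r"
  by (simp add: re_def to_complex_mult to_complex_of_real)

lemma re_of_real: "re (of_real r) = r"
  by (simp add: re_def to_complex_of_real)

lemma re_0: "re 0 = 0"
  using re_of_real[of 0] by simp

lemma re_scaleR: "re (r *\<^sub>R a) = r * re a"
  by (simp add: re_def to_complex_scaleR)

lemma re_le_norm: "re a \<le> norm a"
  by (metis re_def norm_to_complex complex_Re_le_cmod)

lemma unimodular_rotation:
  fixes a :: "'k::real_or_complex"
  shows "\<exists>u. norm u = 1 \<and> u * a = of_real (norm a)"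
proof (cases "a = 0")
  case False
  then show ?thesis by (intro exI[of _ "of_real (norm a) / a"]) (simp add: norm_divide)
qed (auto intro: exI[of _ 1])

text \<open>
  In the closed unit disc, a real part close to 1 makes the whole number close to 1. The
  quadratic gap is what Pythagoras gives.
\<close>

lemma norm_one_minus_le:
  fixes c :: "'k::real_or_complex"
  assumes "norm c \<le> 1" "re c > 1 - s\<^sup>2 / 2" "0 \<le> s"
  shows "norm (1 - c) \<le> s"
proof -
  let ?z = "to_complex c"
  have z: "(Re ?z)\<^sup>2 + (Im ?z)\<^sup>2 \<le> 1"
    using assms(1) by (simp add: cmod_power2[symmetric] norm_to_complex power_le_one)
  have "to_complex (1 - c) = 1 - ?z"
    using to_complex_add[of "1 - c" c] by (simp add: to_complex_1 algebra_simps)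
  then have "(norm (1 - c))\<^sup>2 = (1 - Re ?z)\<^sup>2 + (Im ?z)\<^sup>2"
    by (metis norm_to_complex cmod_power2 complex.sel minus_complex.sel one_complex.sel diff_0 power2_minus)
  also have "\<dots> \<le> s\<^sup>2" using z assms(2) by (simp add: re_def power2_eq_square algebra_simps)
  finally show ?thesis using assms(3) by (rule power2_le_imp_le)
qed

section \<open>Functionals over the scalar field\<close>

context banach_over
begin

lemma linear_over_imp_linear:
  fixes \<phi> :: "'a \<Rightarrow> 'k"
  assumes "Vector_Spaces.linear scale (*) \<phi>"
  shows "linear \<phi>"
proof (rule linearI)
  show "\<phi> (x + y) = \<phi> x + \<phi> y" for x y
    using assms by (simp add: Vector_Spaces.linear_iff)
  show "\<phi> (r *\<^sub>R x) = r *\<^sub>R \<phi> x" for r x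
    using assms by (simp add: Vector_Spaces.linear_iff scaleR_conv_of_real flip: scale_of_real)
qed

lemma bounded_linear_over_functionalI:
  fixes \<phi> :: "'a \<Rightarrow> 'k"
  assumes add: "\<And>x y. \<phi> (x + y) = \<phi> x + \<phi> y" and scale: "\<And>c x. \<phi> (scale c x) = c * \<phi> x"
    and bound: "\<And>x. norm (\<phi> x) \<le> C * norm x"
  shows "bounded_linear_over scale (*) \<phi>"
proof -
  have l: "Vector_Spaces.linear scale (*) \<phi>"
    using add scale vector_space_axioms vector_space_over_itself.vector_space_axioms
    by (auto simp: Vector_Spaces.linear_iff)
  have "bounded_linear \<phi>"
    using linear_over_imp_linear[OF l] bound
    by (auto simp: bounded_linear_def bounded_linear_axioms_def mult.commute)
  with l show ?thesis by (simp add: bounded_linear_over_def)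
qed

text \<open>
  Real functionals suffice to describe slices: over the complex numbers \<open>g\<close> is the real part of
  \<open>g x - \<i> g (\<i> x)\<close>, and a rotation of \<open>x\<close> transfers the bound on \<open>g\<close> to the modulus. This is how
  the real Hahn-Banach theorem serves both scalar fields.
\<close>

lemma real_functional_extends:
  fixes g :: "'a \<Rightarrow> real"
  assumes g: "linear g" and bound: "\<And>x. g x \<le> C * norm x"
  shows "\<exists>\<phi>. bounded_linear_over scale (*) \<phi> \<and> (\<forall>x. re (\<phi> x) = g x) \<and>
    (\<forall>x. norm (\<phi> x) \<le> C * norm x)"
proof -
  have gadd: "g (x + y) = g x + g y" and gsc: "g (r *\<^sub>R x) = r * g x" for x y r
    using linear_add[OF g] linear_cmul[OF g] by auto
  have "\<exists>\<phi>. (\<forall>x y. \<phi> (x + y) = \<phi> x + \<phi> y) \<and> (\<forall>c x. \<phi> (scale c x) = c * \<phi> x) \<and>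
    (\<forall>x. re (\<phi> x) = g x)"
  proof (cases "range (to_complex :: 'k \<Rightarrow> complex) = \<real>")
    case True
    have c: "c = of_real (re c)" for c :: 'k
    proof -
      have "to_complex c = to_complex (of_real (re c) :: 'k)"
        using True by (metis rangeI Reals_cases Re_complex_of_real re_def to_complex_of_real)
      then have "to_complex (c - of_real (re c)) = 0"
        using to_complex_add[of "c - of_real (re c)" "of_real (re c)"] by simp
      then show ?thesis using norm_to_complex[of "c - of_real (re c)"] by simp
    qed
    have "g (scale c x) = re c * g x" for c x
      by (subst c) (simp only: scale_of_real gsc)
    then show ?thesis
      by (intro exI[of _ "\<lambda>x. of_real (g x)"]) (simp add: gadd re_of_real, metis c)
  next
    case False
    then have surj: "range (to_complex :: 'k \<Rightarrow> complex) = UNIV" using range_to_complex by blast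
    then obtain i :: 'k where i: "to_complex i = \<i>" by (metis rangeE UNIV_I)
    have inj: "c = d" if "to_complex c = to_complex d" for c d :: 'k
      using to_complex_add[of "c - d" d] norm_to_complex[of "c - d"] that by simp
    have ii: "i * i = - 1"
    proof -
      have "to_complex (i * i + 1) = 0" by (simp add: to_complex_add to_complex_mult i to_complex_1)
      then have "i * i + 1 = 0" using norm_to_complex[of "i * i + 1"] by simp
      then show ?thesis by (simp add: eq_neg_iff_add_eq_0)
    qed
    have decomp: "\<exists>a b. c = of_real a + i * of_real b" for c :: 'k
      by (rule exI[of _ "Re (to_complex c)"], rule exI[of _ "Im (to_complex c)"], rule inj)
        (simp add: to_complex_add to_complex_mult i to_complex_of_real complex_eq)
    define \<phi> where "\<phi> x = of_real (g x) - i * of_real (g (scale i x))" for x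
    have \<phi>_add: "\<phi> (x + y) = \<phi> x + \<phi> y" for x y
      by (simp add: \<phi>_def scale_right_distrib gadd algebra_simps)
    have \<phi>_r: "\<phi> (scale (of_real a) x) = of_real a * \<phi> x" for a x
    proof -
      have "scale i (scale (of_real a) x) = a *\<^sub>R scale i x"
        by (metis scale_of_real scale_left_commute)
      then show ?thesis by (simp add: \<phi>_def scale_of_real gsc algebra_simps)
    qed
    have \<phi>_i: "\<phi> (scale i x) = i * \<phi> x" for x
    proof -
      have "scale i (scale i x) = - x" by (simp add: ii)
      then have "\<phi> (scale i x) = of_real (g (scale i x)) + i * of_real (g x)"
        by (simp add: \<phi>_def linear_neg[OF g])
      also have "\<dots> = - (i * i) * of_real (g (scale i x)) + i * of_real (g x)"
        by (simp add: ii)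
      finally show ?thesis by (simp add: \<phi>_def algebra_simps)
    qed
    have "\<phi> (scale c x) = c * \<phi> x" for c x
    proof -
      obtain a b where c: "c = of_real a + i * of_real b" using decomp by blast
      have "scale c x = scale (of_real a) x + scale i (scale (of_real b) x)"
        by (simp add: c scale_left_distrib)
      then show ?thesis by (simp only: \<phi>_add \<phi>_r \<phi>_i c distrib_right mult.assoc)
    qed
    moreover have "re (\<phi> x) = g x" for x
    proof -
      have "re (i * of_real r) = 0" for r
        by (simp add: re_def to_complex_mult to_complex_of_real i)
      moreover have "\<phi> x = of_real (g x) + i * of_real (- g (scale i x))" by (simp add: \<phi>_def)
      ultimately show ?thesis by (simp add: re_add re_of_real del: of_real_minus)
    qed
    ultimately show ?thesis using \<phi>_add by blast
  qed
  then obtain \<phi> where \<phi>: "\<And>x y. \<phi> (x + y) = \<phi> x + \<phi> y" "\<And>c x. \<phi> (scale c x) = c * \<phi> x"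
    "\<And>x. re (\<phi> x) = g x" by blast
  have "norm (\<phi> x) \<le> C * norm x" for x
  proof -
    obtain u :: 'k where u: "norm u = 1" "u * \<phi> x = of_real (norm (\<phi> x))"
      using unimodular_rotation by blast
    have "norm (\<phi> x) = re (\<phi> (scale u x))" by (simp add: \<phi>(2) u re_of_real)
    also have "\<dots> \<le> C * norm (scale u x)" using \<phi>(3) bound by simp
    finally show ?thesis by (simp add: norm_scale u)
  qed
  with \<phi> bounded_linear_over_functionalI[OF \<phi>(1,2)] show ?thesis by blast
qed

end

lemma bounded_linear_if_le:
  fixes h :: "'a::real_normed_vector \<Rightarrow> real"
  assumes "linear h" "\<And>x. h x \<le> C * norm x"
  shows "bounded_linear h"
proof -
  have "norm (h x) \<le> norm x * C" for x
    using assms(2)[of x] assms(2)[of "- x"] by (auto simp: linear_neg[OF assms(1)] mult.commute)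
  with assms(1) show ?thesis by (auto simp: bounded_linear_def bounded_linear_axioms_def)
qed

lemma onorm_point:
  fixes f :: "'a::real_normed_vector \<Rightarrow> 'b::real_normed_vector"
  assumes f: "bounded_linear f" and b: "0 \<le> b" "b < onorm f"
  shows "\<exists>x. norm x \<le> 1 \<and> b < norm (f x)"
proof -
  obtain x where x: "b * norm x < norm (f x)" using onorm_bound[OF b(1), of f] b(2) by (meson leD leI)
  have "x \<noteq> 0" using x by (auto simp: linear_0[OF bounded_linear.linear[OF f]])
  then have "b < norm (f ((1 / norm x) *\<^sub>R x))"
    using x by (simp add: linear_cmul[OF bounded_linear.linear[OF f]] field_simps)
  then show ?thesis using \<open>x \<noteq> 0\<close> by (intro exI[of _ "(1 / norm x) *\<^sub>R x"]) simp
qed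

section \<open>Caps of the unit ball and the Daugavet property\<close>

text \<open>
  A slice in which the height of the cutting hyperplane is a free parameter and the functional is
  only real-valued. A sum of functionals then gives a cap without computing its supremum.
\<close>

definition cap :: "('a::real_normed_vector \<Rightarrow> real) \<Rightarrow> real \<Rightarrow> 'a set" where
  "cap h c = {z. norm z \<le> 1 \<and> c < h z}"

context banach_over
begin

lemma functional_add:
  "bounded_linear_over scale ((*) :: 'k \<Rightarrow> 'k \<Rightarrow> 'k) \<phi> \<Longrightarrow> \<phi> (x + y) = \<phi> x + \<phi> y"
  and functional_scale:
  "bounded_linear_over scale ((*) :: 'k \<Rightarrow> 'k \<Rightarrow> 'k) \<phi> \<Longrightarrow> \<phi> (scale c x) = c * \<phi> x"
  by (simp_all add: bounded_linear_over_def Vector_Spaces.linear_iff)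

lemma functional_bounded_linear:
  "bounded_linear_over scale ((*) :: 'k \<Rightarrow> 'k \<Rightarrow> 'k) \<phi> \<Longrightarrow> bounded_linear \<phi>"
  by (simp add: bounded_linear_over_def)

lemma functional_norm_le:
  assumes "bounded_linear_over scale ((*) :: 'k \<Rightarrow> 'k \<Rightarrow> 'k) \<phi>" "onorm \<phi> = 1"
  shows "norm (\<phi> x) \<le> norm x"
  using onorm[OF functional_bounded_linear[OF assms(1)], of x] assms(2) by simp

lemma bounded_linear_re_functional:
  assumes "bounded_linear_over scale ((*) :: 'k \<Rightarrow> 'k \<Rightarrow> 'k) \<phi>"
  shows "bounded_linear (\<lambda>x. re (\<phi> x))"
proof -
  have b: "bounded_linear \<phi>" by (rule functional_bounded_linear[OF assms])
  have "re (\<phi> x) \<le> onorm \<phi> * norm x" for x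
    using re_le_norm onorm[OF b] order_trans by blast
  moreover have "linear (\<lambda>x. re (\<phi> x))"
    by (rule linearI)
      (simp_all add: linear_add[OF bounded_linear.linear[OF b]]
        linear_cmul[OF bounded_linear.linear[OF b]] re_add re_scaleR)
  ultimately show ?thesis by (rule bounded_linear_if_le[rotated])
qed

lemma normalize_functional:
  assumes \<phi>: "bounded_linear_over scale ((*) :: 'k \<Rightarrow> 'k \<Rightarrow> 'k) \<phi>" and "\<phi> x \<noteq> 0"
  shows "\<exists>\<psi>. bounded_linear_over scale ((*) :: 'k \<Rightarrow> 'k \<Rightarrow> 'k) \<psi> \<and> onorm \<psi> = 1 \<and>
    (\<forall>x. \<phi> x = of_real (onorm \<phi>) * \<psi> x)"
proof -
  have b: "bounded_linear \<phi>" by (rule functional_bounded_linear[OF \<phi>])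
  have N: "onorm \<phi> > 0" using onorm_pos_lt[OF b] assms(2) by blast
  define \<psi> where "\<psi> x = (1 / onorm \<phi>) *\<^sub>R \<phi> x" for x
  have "bounded_linear_over scale (*) \<psi>"
    using onorm[OF b] N
    by (intro bounded_linear_over_functionalI[where C = 1])
      (auto simp: \<psi>_def functional_add[OF \<phi>] functional_scale[OF \<phi>] algebra_simps divide_le_eq)
  moreover have "onorm \<psi> = 1" unfolding \<psi>_def using N by (simp add: onorm_scaleR[OF b])
  moreover have "\<forall>x. \<phi> x = of_real (onorm \<phi>) * \<psi> x"
    using N by (simp add: \<psi>_def scaleR_conv_of_real)
  ultimately show ?thesis by blast
qed

lemma norm_one_functional_exists:
  "\<exists>\<phi>. bounded_linear_over scale ((*) :: 'k \<Rightarrow> 'k \<Rightarrow> 'k) \<phi> \<and> onorm \<phi> = 1"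
proof -
  obtain v :: 'a where v: "v \<noteq> 0" using nonzero by blast
  obtain g where g: "linear g" "\<And>x. g x \<le> norm x" "g v = norm v" using norming_functional by blast
  obtain \<phi> :: "'a \<Rightarrow> 'k" where \<phi>: "bounded_linear_over scale (*) \<phi>" "\<And>x. re (\<phi> x) = g x"
    using real_functional_extends[of g 1] g by auto
  have "\<phi> v \<noteq> 0" using \<phi>(2)[of v] g(3) v by (auto simp: re_0)
  from normalize_functional[OF \<phi>(1) this] show ?thesis by blast
qed

text \<open>
  For a nonzero functional this is rescaling. If the functional is zero, the nonempty cap is the
  whole ball and any functional of norm 1 will do.
\<close>

lemma cap_contains_normalized_slice:
  fixes h :: "'a \<Rightarrow> real"
  assumes h: "bounded_linear h" and ne: "cap h c \<noteq> {}"
  shows "\<exists>\<phi> d. bounded_linear_over scale ((*) :: 'k \<Rightarrow> 'k \<Rightarrow> 'k) \<phi> \<and> onorm \<phi> = 1 \<and> d < 1 \<and>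
    cap (\<lambda>x. re (\<phi> x)) d \<subseteq> cap h c"
proof (cases "\<forall>x. h x = 0")
  case True
  then have "cap (\<lambda>x. re (\<phi> x)) 0 \<subseteq> cap h c" for \<phi> :: "'a \<Rightarrow> 'k"
    using ne by (auto simp: cap_def)
  with norm_one_functional_exists show ?thesis using zero_less_one by blast
next
  case False
  then obtain v where v: "h v \<noteq> 0" by blast
  have "h x \<le> onorm h * norm x" for x using onorm[OF h, of x] by simp
  then obtain \<phi> :: "'a \<Rightarrow> 'k" where \<phi>: "bounded_linear_over scale (*) \<phi>" "\<And>x. re (\<phi> x) = h x"
    using real_functional_extends[OF bounded_linear.linear[OF h], of "onorm h"] by blast
  have nz: "\<phi> v \<noteq> 0" using \<phi>(2)[of v] v by (auto simp: re_0)
  obtain \<psi> where \<psi>: "bounded_linear_over scale (*) \<psi>" "onorm \<psi> = 1"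
    "\<And>x. \<phi> x = of_real (onorm \<phi>) * \<psi> x"
    using normalize_functional[OF \<phi>(1) nz] by blast
  have N: "onorm \<phi> > 0"
    using onorm_pos_lt[OF functional_bounded_linear[OF \<phi>(1)]] nz by blast
  have h\<psi>: "h x = onorm \<phi> * re (\<psi> x)" for x
    using \<phi>(2)[of x] \<psi>(3)[of x] by (simp add: re_of_real_mult)
  have eq: "cap (\<lambda>x. re (\<psi> x)) (c / onorm \<phi>) = cap h c"
    using N by (auto simp: cap_def h\<psi> field_simps)
  obtain z where z: "norm z \<le> 1" "c / onorm \<phi> < re (\<psi> z)"
    using ne unfolding eq[symmetric] by (auto simp: cap_def)
  have "re (\<psi> z) \<le> 1"
    using re_le_norm[of "\<psi> z"] functional_norm_le[OF \<psi>(1,2), of z] z(1) by linarith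
  then have "c / onorm \<phi> < 1" using z(2) by linarith
  with \<psi>(1,2) eq show ?thesis by blast
qed

text \<open>
  The operator \<open>\<phi> \<otimes> z0\<close> has norm \<open>norm z0\<close>, so some \<open>z\<close> in the ball almost attains
  \<open>norm z0 + 1\<close> under its sum with the identity. Multiplying \<open>z\<close> by a unimodular scalar makes
  \<open>\<phi> z\<close> real and nonnegative without changing that norm.
\<close>

lemma Daugavet_rank_one_point:
  assumes D: "Daugavet_property scale"
    and \<phi>: "bounded_linear_over scale ((*) :: 'k \<Rightarrow> 'k \<Rightarrow> 'k) \<phi>" "onorm \<phi> = 1"
    and z0: "z0 \<noteq> 0" and e: "0 < e"
  shows "\<exists>z r. norm z \<le> 1 \<and> 0 \<le> r \<and> r \<le> 1 \<and> \<phi> z = of_real r \<and>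
    norm z0 + 1 - e < norm (z + r *\<^sub>R z0)"
proof -
  define T where "T z = scale (\<phi> z) z0" for z
  have T_add: "T (x + y) = T x + T y" and T_scale: "T (scale c x) = scale c (T x)" for x y c
    by (simp_all add: T_def functional_add[OF \<phi>(1)] functional_scale[OF \<phi>(1)] scale_left_distrib)
  have T_norm: "norm (T x) = norm (\<phi> x) * norm z0" for x by (simp add: T_def norm_scale)
  have T_lin: "bounded_linear T"
  proof (rule bounded_linear_intro[where K = "norm z0"])
    show "T (r *\<^sub>R x) = r *\<^sub>R T x" for r x using T_scale[of "of_real r"] by (simp add: scale_of_real)
    show "norm (T x) \<le> norm x * norm z0" for x
      unfolding T_norm using functional_norm_le[OF \<phi>] by (rule mult_right_mono) simp
  qed (rule T_add)
  have "\<exists>v. \<phi> v \<noteq> 0"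
    using \<phi>(2) onorm_eq_0[OF functional_bounded_linear[OF \<phi>(1)]] by auto
  then obtain v where v: "\<phi> v \<noteq> 0" by blast
  have "range T = span {z0}"
  proof -
    have "scale c z0 \<in> range T" for c
      using v by (intro image_eqI[of _ _ "scale (c / \<phi> v) v"])
        (simp_all add: T_def functional_scale[OF \<phi>(1)])
    then show ?thesis unfolding span_singleton by (auto simp: T_def)
  qed
  then have "dim (range T) = 1" using z0 by (simp add: dim_eq_card_independent)
  moreover have "bounded_linear_over scale scale T"
    using T_lin vector_space_axioms
    by (simp add: bounded_linear_over_def Vector_Spaces.linear_iff T_add T_scale)
  ultimately have "onorm (\<lambda>x. x + T x) = 1 + onorm T"
    using D by (simp add: Daugavet_property_def)
  moreover have "norm z0 \<le> onorm T"
  proof -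
    have "norm (\<phi> x) \<le> (onorm T / norm z0) * norm x" for x
      using onorm[OF T_lin, of x] z0 by (simp add: T_norm field_simps)
    then have "onorm \<phi> \<le> onorm T / norm z0"
      by (intro onorm_bound) (simp_all add: onorm_pos_le[OF T_lin])
    with \<phi>(2) z0 show ?thesis by (simp add: field_simps)
  qed
  ultimately have less: "max 0 (norm z0 + 1 - e) < onorm (\<lambda>x. x + T x)"
    unfolding max_less_iff_conj
    using e norm_ge_zero[of z0] by linarith
  obtain w where w: "norm w \<le> 1" "norm z0 + 1 - e < norm (w + T w)"
    using onorm_point[OF bounded_linear_add[OF bounded_linear_ident T_lin] _ less] by auto
  obtain u where u: "norm u = 1" "u * \<phi> w = of_real (norm (\<phi> w))"
    using unimodular_rotation by blast
  let ?z = "scale u w" and ?r = "norm (\<phi> w)"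
  have \<phi>z: "\<phi> ?z = of_real ?r" using u(2) by (simp add: functional_scale[OF \<phi>(1)])
  have "?z + ?r *\<^sub>R z0 = ?z + T ?z" by (simp add: T_def \<phi>z scale_of_real)
  also have "\<dots> = scale u (w + T w)" by (simp add: T_scale scale_right_distrib)
  finally have "norm (?z + ?r *\<^sub>R z0) = norm (w + T w)" by (simp add: norm_scale u(1))
  moreover have "?r \<le> 1" using functional_norm_le[OF \<phi>, of w] w(1) by linarith
  ultimately show ?thesis using w u \<phi>z
    by (intro exI[of _ ?z] exI[of _ ?r]) (simp add: norm_scale)
qed

text \<open>
  Let \<open>z\<close> be a point of the ball with \<open>\<phi> z = of_real r\<close> and \<open>norm (z + r *\<^sub>R z0)\<close> almost
  \<open>norm z0 + 1\<close>, and let \<open>g\<close> be a norming functional of \<open>z + r *\<^sub>R z0\<close>. The functional \<open>g + g z0 * re \<phi>\<close> is at most \<open>norm z0 + 1\<close> on the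
  ball. Where it is almost that large, both of its summands are almost maximal: \<open>\<phi>\<close> is almost 1,
  so the point lies in the given cap, and \<open>g\<close> is almost 1 there and almost \<open>norm z0\<close> at \<open>z0\<close>, so
  the sum with \<open>z0\<close> has large norm. Passing to a smaller cap, and not only to a single point,
  is what permits iteration.
\<close>

lemma Daugavet_subcap_nonzero:
  fixes h :: "'a \<Rightarrow> real"
  assumes D: "Daugavet_property scale" and h: "bounded_linear h" and ne: "cap h c \<noteq> {}"
    and z0: "z0 \<noteq> 0" and e: "0 < e"
  shows "\<exists>h' c'. bounded_linear h' \<and> cap h' c' \<noteq> {} \<and> cap h' c' \<subseteq> cap h c \<and>
    (\<forall>w\<in>cap h' c'. norm z0 + 1 - e \<le> norm (z0 + w))"
proof -
  obtain \<phi> d where \<phi>: "bounded_linear_over scale ((*) :: 'k \<Rightarrow> 'k \<Rightarrow> 'k) \<phi>" "onorm \<phi> = 1"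
    and d: "d < 1" "cap (\<lambda>x. re (\<phi> x)) d \<subseteq> cap h c"
    using cap_contains_normalized_slice[OF h ne] by blast
  define a where "a = norm z0"
  have a: "0 < a" using z0 by (simp add: a_def)
  \<comment> \<open>The three bounds give the norm estimate, the positivity of \<open>g z0\<close>, and the height \<open>d\<close>.\<close>
  define e' where "e' = min (e / 2) (min (a / 2) (a * (1 - d)))"
  have e': "0 < e'" "2 * e' \<le> e" "2 * e' \<le> a" "e' \<le> a * (1 - d)"
    using e a d(1) by (auto simp: e'_def)
  obtain z r where z: "norm z \<le> 1" "0 \<le> r" "r \<le> 1" "\<phi> z = of_real r"
    "a + 1 - e' < norm (z + r *\<^sub>R z0)"
    using Daugavet_rank_one_point[OF D \<phi> z0 e'(1)] unfolding a_def by blast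
  obtain g where g: "linear g" "\<And>x. g x \<le> norm x" "g (z + r *\<^sub>R z0) = norm (z + r *\<^sub>R z0)"
    using norming_functional by blast
  have sum: "a + 1 - e' < g z + r * g z0"
    using z(5) g(3) by (simp add: linear_add[OF g(1)] linear_cmul[OF g(1)])
  have "a - e' < r * g z0" using sum g(2)[of z] z(1) by linarith
  then have "0 < r * g z0" using e'(1,3) by linarith
  then have gz0: "0 < g z0" using z(2) by (simp add: zero_less_mult_iff)
  have "r * g z0 \<le> g z0" using z(3) gz0 by (simp add: mult_le_cancel_right1)
  with \<open>a - e' < r * g z0\<close> have gz0_ge: "a - e' < g z0" by linarith
  have gz0_le: "g z0 \<le> a" using g(2)[of z0] by (simp add: a_def)
  define h' where "h' w = g w + g z0 * re (\<phi> w)" for w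
  have "bounded_linear h'"
    unfolding h'_def using bounded_linear_if_le[of g 1] g(1,2)
    by (intro bounded_linear_add bounded_linear_const_mult bounded_linear_re_functional \<phi>(1)) simp_all
  moreover have "z \<in> cap h' (a + 1 - e')"
    using z(1,4) sum by (simp add: cap_def h'_def re_of_real mult.commute)
  moreover have "w \<in> cap h c \<and> norm z0 + 1 - e \<le> norm (z0 + w)" if w: "w \<in> cap h' (a + 1 - e')" for w
  proof -
    have w1: "norm w \<le> 1" and wh: "a + 1 - e' < g w + g z0 * re (\<phi> w)"
      using w by (auto simp: cap_def h'_def)
    have re1: "re (\<phi> w) \<le> 1"
      using re_le_norm[of "\<phi> w"] functional_norm_le[OF \<phi>, of w] w1 by linarith
    have "g z0 * re (\<phi> w) \<le> g z0" using gz0 re1 by (simp add: mult_le_cancel_left1)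
    then have gw: "1 - e' < g w" using wh gz0_le by linarith
    have *: "a - e' < g z0 * re (\<phi> w)" using wh g(2)[of w] w1 by linarith
    then have "0 < g z0 * re (\<phi> w)" using e'(1,3) by linarith
    then have "0 < re (\<phi> w)" using gz0 by (simp add: zero_less_mult_iff)
    then have "g z0 * re (\<phi> w) \<le> a * re (\<phi> w)" using gz0_le by (simp add: mult_right_mono)
    then have "a * d < a * re (\<phi> w)" using * e'(4) by (simp add: algebra_simps)
    then have "d < re (\<phi> w)" using a by simp
    then have "w \<in> cap h c" using d(2) w1 by (auto simp: cap_def)
    moreover have "norm z0 + 1 - e \<le> norm (z0 + w)"
      using g(2)[of "z0 + w"] gw gz0_ge e'(2) by (simp add: linear_add[OF g(1)] a_def)
    ultimately show ?thesis by blast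
  qed
  ultimately show ?thesis by blast
qed

lemma Daugavet_subcap:
  fixes h :: "'a \<Rightarrow> real"
  assumes D: "Daugavet_property scale" and h: "bounded_linear h" and ne: "cap h c \<noteq> {}"
    and e: "0 < e"
  shows "\<exists>h' c'. bounded_linear h' \<and> cap h' c' \<noteq> {} \<and> cap h' c' \<subseteq> cap h c \<and>
    (\<forall>w\<in>cap h' c'. norm z0 + 1 - e \<le> norm (z0 + w))"
proof (cases "z0 = 0")
  case True
  \<comment> \<open>If \<open>w\<close> is norming for one nonzero \<open>v\<close>, the triangle inequality makes \<open>norm w\<close> almost 1.\<close>
  obtain v :: 'a where v: "v \<noteq> 0" using nonzero by blast
  obtain h' c' where h': "bounded_linear h'" "cap h' c' \<noteq> {}" "cap h' c' \<subseteq> cap h c"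
    "\<And>w. w \<in> cap h' c' \<Longrightarrow> norm v + 1 - e \<le> norm (v + w)"
    using Daugavet_subcap_nonzero[OF D h ne v e] by blast
  have "1 - e \<le> norm w" if "w \<in> cap h' c'" for w
    using h'(4)[OF that] norm_triangle_ineq[of v w] by linarith
  then have "\<forall>w\<in>cap h' c'. norm z0 + 1 - e \<le> norm (z0 + w)" using True by simp
  with h'(1-3) show ?thesis by blast
qed (rule Daugavet_subcap_nonzero[OF D h ne _ e])

lemma Daugavet_subcap_finite:
  fixes h :: "'a \<Rightarrow> real" and F :: "'a set"
  assumes D: "Daugavet_property scale" and e: "0 < e" and "finite F"
    and h: "bounded_linear h" and ne: "cap h c \<noteq> {}"
  shows "\<exists>h' c'. bounded_linear h' \<and> cap h' c' \<noteq> {} \<and> cap h' c' \<subseteq> cap h c \<and>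
    (\<forall>k\<in>F. \<forall>w\<in>cap h' c'. norm k + 1 - e \<le> norm (k + w))"
  using \<open>finite F\<close>
proof (induction F)
  case empty
  then show ?case using h ne by auto
next
  case (insert k F)
  then obtain h' c' where h': "bounded_linear h'" "cap h' c' \<noteq> {}" "cap h' c' \<subseteq> cap h c"
    "\<forall>k\<in>F. \<forall>w\<in>cap h' c'. norm k + 1 - e \<le> norm (k + w)" by blast
  obtain h'' c'' where "bounded_linear h''" "cap h'' c'' \<noteq> {}" "cap h'' c'' \<subseteq> cap h' c'"
    "\<forall>w\<in>cap h'' c''. norm k + 1 - e \<le> norm (k + w)"
    using Daugavet_subcap[OF D h'(1,2) e] by blast
  with h' show ?case by (intro exI[of _ h''] exI[of _ c'']) blast
qed

text \<open>
  A finite net of \<open>K\<close> reduces this to finitely many successive shrinkings.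
\<close>

lemma Daugavet_subcap_compact:
  fixes h :: "'a \<Rightarrow> real" and K :: "'a set"
  assumes D: "Daugavet_property scale" and e: "0 < e" and K: "compact K"
    and h: "bounded_linear h" and ne: "cap h c \<noteq> {}"
  shows "\<exists>h' c'. bounded_linear h' \<and> cap h' c' \<noteq> {} \<and> cap h' c' \<subseteq> cap h c \<and>
    (\<forall>k\<in>K. \<forall>w\<in>cap h' c'. norm k + 1 - e \<le> norm (k + w))"
proof -
  obtain F where F: "finite F" "K \<subseteq> (\<Union>x\<in>F. ball x (e / 4))"
    using K e unfolding compact_eq_totally_bounded by (metis divide_pos_pos zero_less_numeral)
  obtain h' c' where h': "bounded_linear h'" "cap h' c' \<noteq> {}" "cap h' c' \<subseteq> cap h c"
    "\<And>k w. k \<in> F \<Longrightarrow> w \<in> cap h' c' \<Longrightarrow> norm k + 1 - e / 2 \<le> norm (k + w)"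
    using Daugavet_subcap_finite[OF D half_gt_zero[OF e] F(1) h ne] by blast
  have "norm k + 1 - e \<le> norm (k + w)" if k: "k \<in> K" and w: "w \<in> cap h' c'" for k w
  proof -
    obtain k' where k': "k' \<in> F" "norm (k' - k) < e / 4" using F(2) k by (auto simp: dist_norm)
    have "norm k' + 1 - e / 2 \<le> norm (k' + w)" by (rule h'(4)[OF k'(1) w])
    moreover have "norm (k' + w) \<le> norm (k + w) + norm (k' - k)"
      using norm_triangle_ineq[of "k + w" "k' - k"] by (simp add: add.commute)
    moreover have "norm k \<le> norm k' + norm (k' - k)"
      using norm_triangle_ineq4[of k' "k' - k"] by simp
    ultimately show ?thesis using k'(2) by linarith
  qed
  with h'(1-3) show ?thesis by blast
qed

end

section \<open>The projective tensor product\<close>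

lemma vector_space_functional: "vector_space (scale_functional :: 'k::field \<Rightarrow> ('c \<Rightarrow> 'k) \<Rightarrow> 'c \<Rightarrow> 'k)"
  by unfold_locales (auto simp: scale_functional_def fun_eq_iff algebra_simps)

interpretation functional: vector_space "scale_functional :: 'k::field \<Rightarrow> ('c \<Rightarrow> 'k) \<Rightarrow> 'c \<Rightarrow> 'k"
  by (rule vector_space_functional)

lemma sum_functional_apply: "(\<Sum>i\<in>A. f i) b = (\<Sum>i\<in>A. f i b)"
  by (induction A rule: infinite_finite_induct) auto

locale projective_tensor = X: banach_over s + Y: banach_over t
  for s :: "'k::real_or_complex \<Rightarrow> 'x::banach \<Rightarrow> 'x" and t :: "'k \<Rightarrow> 'y::banach \<Rightarrow> 'y" +
  fixes r :: "'k \<Rightarrow> 'z::banach \<Rightarrow> 'z" and \<iota> :: "(('x \<Rightarrow> 'y \<Rightarrow> 'k) \<Rightarrow> 'k) \<Rightarrow> 'z"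
  assumes completion: "projective_tensor_product s t r \<iota>"

sublocale projective_tensor \<subseteq> Z: banach_over r
  using completion by (simp add: projective_tensor_product_def)

context projective_tensor
begin

abbreviation "alg \<equiv> algebraic_tensor_product s t"

definition tensor :: "'x \<Rightarrow> 'y \<Rightarrow> 'z" where
  "tensor x y = \<iota> (simple_tensor s t x y)"

lemma embedding_add: "u \<in> alg \<Longrightarrow> v \<in> alg \<Longrightarrow> \<iota> (u + v) = \<iota> u + \<iota> v"
  and embedding_scale: "u \<in> alg \<Longrightarrow> \<iota> (scale_functional c u) = r c (\<iota> u)"
  and norm_embedding: "u \<in> alg \<Longrightarrow> norm (\<iota> u) = projective_norm s t u"
  and embedding_dense: "closure (\<iota> ` alg) = UNIV"
  using completion by (simp_all add: projective_tensor_product_def)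

lemma simple_tensor_in_alg: "simple_tensor s t x y \<in> alg"
  unfolding algebraic_tensor_product_def by (intro functional.span_base) blast

lemma alg_add: "u \<in> alg \<Longrightarrow> v \<in> alg \<Longrightarrow> u + v \<in> alg"
  and alg_scale: "u \<in> alg \<Longrightarrow> scale_functional c u \<in> alg"
  and alg_0: "0 \<in> alg"
  unfolding algebraic_tensor_product_def
  by (rule functional.span_add functional.span_scale functional.span_zero; assumption?)+

lemma alg_sum: "(\<Sum>i\<in>A. simple_tensor s t (x i) (y i)) \<in> alg"
  unfolding algebraic_tensor_product_def
  by (intro functional.span_sum functional.span_base) blast

lemma simple_tensor_bilinear:
  "simple_tensor s t (x + x') y = simple_tensor s t x y + simple_tensor s t x' y"
  "simple_tensor s t x (y + y') = simple_tensor s t x y + simple_tensor s t x y'"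
  "simple_tensor s t (s c x) y = scale_functional c (simple_tensor s t x y)"
  "simple_tensor s t x (t c y) = scale_functional c (simple_tensor s t x y)"
  by (auto simp: fun_eq_iff simple_tensor_def scale_functional_def bilinear_form_def Vector_Spaces.linear_iff)

text \<open>
  A linear combination of simple tensors is a sum of simple tensors, since scalars are absorbed
  in the first factor.
\<close>

lemma alg_representation:
  assumes "u \<in> alg"
  shows "\<exists>n x y. u = (\<Sum>i=1..n::nat. simple_tensor s t (x i) (y i))"
  using assms unfolding algebraic_tensor_product_def
proof (induction rule: functional.span_induct_alt)
  case base
  show ?case by (rule exI[of _ 0]) simp
next
  case (step c v u)
  obtain a b where v: "v = simple_tensor s t a b" using step(1) by blast
  obtain n x y where u: "u = (\<Sum>i=1..n::nat. simple_tensor s t (x i) (y i))" using step(2) by blast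
  have "scale_functional c v + u =
      (\<Sum>i=1..Suc n. simple_tensor s t ((x(Suc n := s c a)) i) ((y(Suc n := b)) i))"
    by (simp add: u v simple_tensor_bilinear add.commute)
  then show ?case by blast
qed

lemma projective_norm_le:
  "u = (\<Sum>i=1..n::nat. simple_tensor s t (x i) (y i)) \<Longrightarrow>
    projective_norm s t u \<le> (\<Sum>i=1..n. norm (x i) * norm (y i))"
  unfolding projective_norm_def
  by (rule cInf_lower) (auto intro!: bdd_belowI[of _ 0] sum_nonneg)

lemma projective_norm_greatest:
  assumes "u \<in> alg"
    and "\<And>n x y. u = (\<Sum>i=1..n::nat. simple_tensor s t (x i) (y i)) \<Longrightarrow>
      C \<le> (\<Sum>i=1..n. norm (x i) * norm (y i))"
  shows "C \<le> projective_norm s t u"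
  unfolding projective_norm_def
  using alg_representation[OF assms(1)] assms(2) by (intro cInf_greatest) blast+

lemma tensor_add_left: "tensor (x + x') y = tensor x y + tensor x' y"
  and tensor_add_right: "tensor x (y + y') = tensor x y + tensor x y'"
  and tensor_scale_left: "tensor (s c x) y = r c (tensor x y)"
  and tensor_scale_right: "tensor x (t c y) = r c (tensor x y)"
  by (simp_all add: tensor_def simple_tensor_bilinear embedding_add embedding_scale simple_tensor_in_alg)

lemma norm_tensor_le: "norm (tensor x y) \<le> norm x * norm y"
  using projective_norm_le[of "simple_tensor s t x y" "\<lambda>_. x" "\<lambda>_. y" 1]
  by (simp add: tensor_def norm_embedding simple_tensor_in_alg)

lemma linear_tensor_right: "linear (tensor x)"
proof (rule linearI)
  show "tensor x (c *\<^sub>R y) = c *\<^sub>R tensor x y" for c y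
    using tensor_scale_right[of x "of_real c" y] by (simp add: Y.scale_of_real Z.scale_of_real)
qed (rule tensor_add_right)

lemma embedding_0: "\<iota> 0 = 0"
  using embedding_add[OF alg_0 alg_0] by simp

lemma embedding_sum: "\<iota> (\<Sum>i\<in>A. simple_tensor s t (x i) (y i)) = (\<Sum>i\<in>A. tensor (x i) (y i))"
proof (induction A rule: infinite_finite_induct)
  case (insert i A)
  then show ?case
    by (simp only: sum.insert[OF insert.hyps] embedding_add[OF simple_tensor_in_alg alg_sum] tensor_def)
next
  case (infinite A)
  then show ?case by (simp only: sum.infinite[OF infinite] embedding_0)
qed (simp only: sum.empty embedding_0)

lemma tensor_0: "tensor x 0 = 0" "tensor 0 y = 0"
  using norm_tensor_le[of x 0] norm_tensor_le[of 0 y] by auto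

text \<open>
  The unit ball of the completion is the closed convex hull of the simple tensors in it, so they
  meet every nonempty cap. In detail: if a functional is at most \<open>c\<close> on these simple tensors, homogeneity
  bounds it by \<open>c\<close> times the projective norm, hence by \<open>c\<close> on the open unit ball of the algebraic
  tensor product, which is dense.
\<close>

lemma cap_contains_tensor:
  fixes h :: "'z \<Rightarrow> real"
  assumes h: "bounded_linear h" and ne: "cap h c \<noteq> {}"
  shows "\<exists>x y. norm x \<le> 1 \<and> norm y \<le> 1 \<and> c < h (tensor x y)"
proof (rule ccontr)
  assume "\<not> ?thesis"
  then have le: "h (tensor x y) \<le> c" if "norm x \<le> 1" "norm y \<le> 1" for x y
    using that by (meson leI)
  note lin = bounded_linear.linear[OF h]
  have c: "0 \<le> c" using le[of 0 0] by (simp add: tensor_0 linear_0[OF lin])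
  have hom: "h (tensor x y) \<le> c * (norm x * norm y)" for x y
  proof (cases "x = 0 \<or> y = 0")
    case True
    then show ?thesis by (auto simp: tensor_0 linear_0[OF lin])
  next
    case False
    define x' y' where "x' = (1 / norm x) *\<^sub>R x" and "y' = (1 / norm y) *\<^sub>R y"
    have "tensor x' y' = (1 / (norm x * norm y)) *\<^sub>R tensor x y"
      using tensor_scale_left[of "of_real (1 / norm x)" x y']
        tensor_scale_right[of x "of_real (1 / norm y)" y]
      by (simp only: X.scale_of_real Y.scale_of_real Z.scale_of_real x'_def y'_def) simp
    moreover have "h (tensor x' y') \<le> c" using False by (intro le) (auto simp: x'_def y'_def)
    ultimately show ?thesis using False by (simp add: linear_cmul[OF lin] field_simps)
  qed
  obtain z where z: "norm z \<le> 1" "c < h z" using ne by (auto simp: cap_def)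
  have "c / h z < 1" using z c by simp
  then obtain a where a: "c / h z < a" "a < 1" using dense by blast
  have "0 \<le> c / h z" using z c by simp
  then have a0: "0 < a" using a(1) by linarith
  have hz: "0 < h z" using z c by linarith
  let ?O = "{w. norm w < 1 \<and> c < h w}"
  have "c < h (a *\<^sub>R z)" using a hz by (simp add: linear_cmul[OF lin] field_simps)
  moreover have "norm (a *\<^sub>R z) < 1"
    using a0 a(2) mult_left_mono[OF z(1), of a] by (simp only: norm_scaleR) linarith
  ultimately have "?O \<inter> closure (\<iota> ` alg) \<noteq> {}" unfolding embedding_dense by blast
  moreover have "open ?O"
    by (intro open_Collect_conj open_Collect_less continuous_intros linear_continuous_on h)
  ultimately have "?O \<inter> \<iota> ` alg \<noteq> {}"
    using open_Int_closure_eq_empty[of ?O "\<iota> ` alg"] by simp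
  then obtain u where u: "u \<in> alg" "norm (\<iota> u) < 1" "c < h (\<iota> u)" by auto
  have "\<not> 1 \<le> projective_norm s t u" using u(2) norm_embedding[OF u(1)] by simp
  then obtain n x y where rep: "u = (\<Sum>i=1..n::nat. simple_tensor s t (x i) (y i))"
    and small: "(\<Sum>i=1..n. norm (x i) * norm (y i)) < 1"
    using projective_norm_greatest[OF u(1), of 1] by (meson not_le)
  have "h (\<iota> u) = (\<Sum>i=1..n. h (tensor (x i) (y i)))"
    by (simp add: rep embedding_sum linear_sum[OF lin])
  also have "\<dots> \<le> (\<Sum>i=1..n. c * (norm (x i) * norm (y i)))" by (intro sum_mono hom)
  also have "\<dots> = c * (\<Sum>i=1..n. norm (x i) * norm (y i))" by (simp add: sum_distrib_left)
  also have "\<dots> \<le> c" using small c by (simp add: mult_left_le)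
  finally show False using u(3) by simp
qed

text \<open>
  Evaluation at the bilinear form \<open>\<phi> x * \<psi> y\<close> is bounded by the projective norm on the algebraic
  tensor product, so it factors through the embedding and extends by Hahn-Banach.
\<close>

lemma tensor_of_functionals:
  assumes \<phi>: "bounded_linear_over s ((*) :: 'k \<Rightarrow> 'k \<Rightarrow> 'k) \<phi>" "\<And>x. norm (\<phi> x) \<le> norm x"
    and \<psi>: "bounded_linear_over t ((*) :: 'k \<Rightarrow> 'k \<Rightarrow> 'k) \<psi>" "\<And>y. norm (\<psi> y) \<le> norm y"
  shows "\<exists>h. bounded_linear h \<and> (\<forall>z. h z \<le> norm z) \<and> (\<forall>x y. h (tensor x y) = re (\<phi> x * \<psi> y))"
proof -
  define b where "b x y = \<phi> x * \<psi> y" for x y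
  have "bilinear_form s t b"
    using X.vector_space_axioms Y.vector_space_axioms vector_space_over_itself.vector_space_axioms
    by (auto simp: bilinear_form_def b_def Vector_Spaces.linear_iff algebra_simps
        X.functional_add[OF \<phi>(1)] X.functional_scale[OF \<phi>(1)]
        Y.functional_add[OF \<psi>(1)] Y.functional_scale[OF \<psi>(1)])
  then have simple: "simple_tensor s t x y b = \<phi> x * \<psi> y" for x y
    by (simp add: simple_tensor_def b_def)
  have bound: "norm (u b) \<le> norm (\<iota> u)" if u: "u \<in> alg" for u
    unfolding norm_embedding[OF u]
  proof (rule projective_norm_greatest[OF u])
    fix n x y assume "u = (\<Sum>i=1..n::nat. simple_tensor s t (x i) (y i))"
    then have "norm (u b) = norm (\<Sum>i=1..n. \<phi> (x i) * \<psi> (y i))"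
      by (simp add: sum_functional_apply simple)
    also have "\<dots> \<le> (\<Sum>i=1..n. norm (x i) * norm (y i))"
      by (intro sum_norm_le) (auto simp: norm_mult intro!: mult_mono \<phi>(2) \<psi>(2))
    finally show "norm (u b) \<le> (\<Sum>i=1..n. norm (x i) * norm (y i))" .
  qed
  have wd: "u b = v b" if uv: "u \<in> alg" "v \<in> alg" "\<iota> u = \<iota> v" for u v
  proof -
    have v': "scale_functional (- 1) v \<in> alg" by (rule alg_scale[OF uv(2)])
    have "\<iota> (u + scale_functional (- 1) v) = \<iota> u + r (- 1) (\<iota> v)"
      by (simp only: embedding_add[OF uv(1) v'] embedding_scale[OF uv(2)])
    also have "\<dots> = 0" by (simp add: uv(3))
    finally have "\<iota> (u + scale_functional (- 1) v) = 0" .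
    then have "(u + scale_functional (- 1) v) b = 0"
      using bound[OF alg_add[OF uv(1) v']] by simp
    then show ?thesis by (simp add: scale_functional_def)
  qed
  \<comment> \<open>By \<open>wd\<close> the choice of a preimage under the embedding does not matter.\<close>
  define f where "f z = re (inv_into alg \<iota> z b)" for z
  have f: "f (\<iota> u) = re (u b)" if u: "u \<in> alg" for u
  proof -
    have "inv_into alg \<iota> (\<iota> u) \<in> alg" "\<iota> (inv_into alg \<iota> (\<iota> u)) = \<iota> u"
      using inv_into_into[OF imageI[OF u]] f_inv_into_f[OF imageI[OF u]] by auto
    from wd[OF this(1) u this(2)] show ?thesis by (simp add: f_def)
  qed
  have scaleR: "c *\<^sub>R \<iota> u = \<iota> (scale_functional (of_real c) u)" if "u \<in> alg" for c u
    by (simp add: embedding_scale[OF that] Z.scale_of_real)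
  have "\<exists>g. linear g \<and> (\<forall>x. g x \<le> norm x) \<and> (\<forall>u\<in>\<iota> ` alg. g u = f u)"
  proof (rule Hahn_Banach)
    show "subspace (\<iota> ` alg)"
      using embedding_0 alg_0 alg_add alg_scale
      by (force simp: subspace_def scaleR simp flip: embedding_add intro: image_eqI[of 0 \<iota> 0])
    show "f (u + v) = f u + f v" if uv: "u \<in> \<iota> ` alg" "v \<in> \<iota> ` alg" for u v
      using uv by (auto simp: f alg_add re_add simp flip: embedding_add)
    show "f (c *\<^sub>R u) = c * f u" if u: "u \<in> \<iota> ` alg" for c u
    proof -
      obtain v where v: "v \<in> alg" "u = \<iota> v" using u by blast
      have "f (c *\<^sub>R u) = re (scale_functional (of_real c) v b)"
        unfolding v(2) scaleR[OF v(1)] by (rule f[OF alg_scale[OF v(1)]])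
      also have "\<dots> = c * f u" by (simp add: v f scale_functional_def re_of_real_mult)
      finally show ?thesis .
    qed
    show "f u \<le> norm u" if "u \<in> \<iota> ` alg" for u
      using that bound order_trans[OF re_le_norm bound] by (auto simp: f)
  qed
  then obtain h where h: "linear h" "\<And>z. h z \<le> norm z" "\<And>u. u \<in> alg \<Longrightarrow> h (\<iota> u) = f (\<iota> u)"
    by blast
  have "h (tensor x y) = re (\<phi> x * \<psi> y)" for x y
    by (simp add: tensor_def h(3) f simple_tensor_in_alg simple)
  moreover have "bounded_linear h" using bounded_linear_if_le[of h 1] h by simp
  ultimately show ?thesis using h(2) by blast
qed

text \<open>
  The lower bound comes from the tensor product of norming functionals of \<open>x\<close> and \<open>y\<close>.
\<close>

lemma norm_tensor: "norm (tensor x y) = norm x * norm y"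
proof (rule antisym[OF norm_tensor_le])
  obtain g where g: "linear g" "\<And>v. g v \<le> norm v" "g x = norm x" using norming_functional by blast
  obtain \<phi> :: "'x \<Rightarrow> 'k" where \<phi>: "bounded_linear_over s (*) \<phi>" "re (\<phi> x) = norm x"
    "\<And>v. norm (\<phi> v) \<le> norm v"
    using X.real_functional_extends[OF g(1), of 1] g by auto
  obtain g' where g': "linear g'" "\<And>v. g' v \<le> norm v" "g' y = norm y" using norming_functional by blast
  obtain \<psi> :: "'y \<Rightarrow> 'k" where \<psi>: "bounded_linear_over t (*) \<psi>" "re (\<psi> y) = norm y"
    "\<And>v. norm (\<psi> v) \<le> norm v"
    using Y.real_functional_extends[OF g'(1), of 1] g' by auto
  obtain u :: 'k where u: "norm u = 1" "u * (\<phi> x * \<psi> y) = of_real (norm (\<phi> x * \<psi> y))"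
    using unimodular_rotation by blast
  obtain h where h: "\<And>z. h z \<le> norm z" "\<And>x y. h (tensor x y) = re (\<phi> x * \<psi> y)"
    using tensor_of_functionals[OF \<phi>(1,3) \<psi>(1,3)] by blast
  have "norm x * norm y \<le> norm (\<phi> x) * norm (\<psi> y)"
    using re_le_norm[of "\<phi> x"] re_le_norm[of "\<psi> y"] \<phi>(2) \<psi>(2) by (intro mult_mono) auto
  also have "\<dots> = re (u * (\<phi> x * \<psi> y))" by (simp only: u(2) re_of_real norm_mult)
  also have "\<dots> = h (tensor (s u x) y)" by (simp add: h(2) X.functional_scale[OF \<phi>(1)] mult.assoc)
  also have "\<dots> \<le> norm (r u (tensor x y))" using h(1) by (simp add: tensor_scale_left)
  finally show "norm x * norm y \<le> norm (tensor x y)" by (simp add: Z.norm_scale u(1))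
qed

end

section \<open>The slice criterion\<close>

text \<open>
  An operator with one-dimensional range is a functional times a vector. The norm of the
  operator is moved into the vector.
\<close>

lemma (in banach_over) rank_one_representation:
  assumes T: "bounded_linear_over scale scale T" and dim1: "dim (range T) = 1"
  shows "\<exists>\<phi> e. bounded_linear_over scale ((*) :: 'k \<Rightarrow> 'k \<Rightarrow> 'k) \<phi> \<and> onorm \<phi> = 1 \<and>
    (\<forall>x. T x = scale (\<phi> x) e)"
proof -
  have T_lin: "bounded_linear T" and T_add: "\<And>x y. T (x + y) = T x + T y"
    and T_scale: "\<And>c x. T (scale c x) = scale c (T x)"
    using T by (auto simp: bounded_linear_over_def Vector_Spaces.linear_iff)
  obtain B where B: "B \<subseteq> range T" "independent B" "range T \<subseteq> span B" "card B = dim (range T)"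
    by (rule basis_exists)
  then obtain b where b: "B = {b}" using dim1 by (metis card_1_singletonE)
  have b0: "b \<noteq> 0" using B(2) b dependent_zero by blast
  have "\<exists>c. T x = scale c b" for x using B(3) b by (auto simp: span_singleton)
  then obtain \<phi> where \<phi>: "\<And>x. T x = scale (\<phi> x) b" by metis
  have "bounded_linear_over scale (*) \<phi>"
  proof (rule bounded_linear_over_functionalI)
    have "scale (\<phi> (x + y)) b = scale (\<phi> x + \<phi> y) b" for x y
      using T_add[of x y] by (simp add: \<phi> scale_left_distrib)
    then show "\<phi> (x + y) = \<phi> x + \<phi> y" for x y using b0 by simp
    have "scale (\<phi> (scale c x)) b = scale (c * \<phi> x) b" for c x
      using T_scale[of c x] by (simp add: \<phi>)
    then show "\<phi> (scale c x) = c * \<phi> x" for c x using b0 by simp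
    show "norm (\<phi> x) \<le> (onorm T / norm b) * norm x" for x
      using onorm[OF T_lin, of x] b0 by (simp add: \<phi> norm_scale field_simps)
  qed
  moreover obtain v where "T v = b" using B(1) b by auto
  then have "\<phi> v \<noteq> 0" using b0 \<phi>[of v] by auto
  ultimately obtain \<psi> where \<psi>: "bounded_linear_over scale ((*) :: 'k \<Rightarrow> 'k \<Rightarrow> 'k) \<psi>" "onorm \<psi> = 1"
    "\<And>x. \<phi> x = of_real (onorm \<phi>) * \<psi> x"
    using normalize_functional by blast
  have "T x = scale (\<psi> x) (onorm \<phi> *\<^sub>R b)" for x
  proof -
    have "T x = scale (\<psi> x) (scale (of_real (onorm \<phi>)) b)"
      using \<phi>[of x] \<psi>(3)[of x] by (simp add: mult.commute)
    then show ?thesis by (simp only: scale_of_real)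
  qed
  with \<psi>(1,2) show ?thesis by blast
qed

text \<open>
  The usual slice criterion. Write \<open>T x = \<phi> x \<cdot> x0\<close> with \<open>onorm \<phi> = 1\<close>. If \<open>x\<close> lies in a thin slice
  of \<open>\<phi>\<close>, then \<open>T x\<close> is close to \<open>x0\<close>, and \<open>x + T x\<close> is almost as long as \<open>x + x0\<close>.
\<close>

lemma (in banach_over) Daugavet_property_if_slice_points:
  assumes pts: "\<And>\<phi> x0 d e. bounded_linear_over scale ((*) :: 'k \<Rightarrow> 'k \<Rightarrow> 'k) \<phi> \<Longrightarrow> onorm \<phi> = 1 \<Longrightarrow>
    0 < d \<Longrightarrow> 0 < e \<Longrightarrow> \<exists>x\<in>cap (\<lambda>x. re (\<phi> x)) (1 - d). norm x0 + 1 - e \<le> norm (x0 + x)"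
  shows "Daugavet_property scale"
  unfolding Daugavet_property_def
proof (intro allI impI, elim conjE)
  fix T assume T: "bounded_linear_over scale scale T" and dim1: "dim (range T) = 1"
  have T_lin: "bounded_linear T" using T by (simp add: bounded_linear_over_def)
  obtain \<phi> x0 where \<phi>: "bounded_linear_over scale ((*) :: 'k \<Rightarrow> 'k \<Rightarrow> 'k) \<phi>" "onorm \<phi> = 1"
    and T\<phi>: "\<And>x. T x = scale (\<phi> x) x0"
    using rank_one_representation[OF T dim1] by blast
  have T_norm: "onorm T \<le> norm x0"
  proof (rule onorm_bound)
    show "norm (T x) \<le> norm x0 * norm x" for x
      using functional_norm_le[OF \<phi>, of x]
      by (simp add: T\<phi> norm_scale mult.commute mult_left_mono)
  qed simp
  have IT: "bounded_linear (\<lambda>x. x + T x)"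
    by (rule bounded_linear_add[OF bounded_linear_ident T_lin])
  show "onorm (\<lambda>x. x + T x) = 1 + onorm T"
  proof (rule antisym)
    show "onorm (\<lambda>x. x + T x) \<le> 1 + onorm T"
      using onorm_triangle[OF bounded_linear_ident T_lin] onorm_id_le[where 'a = 'a] by linarith
    have "1 + norm x0 \<le> onorm (\<lambda>x. x + T x) + e" if e: "0 < e" for e
    proof -
      \<comment> \<open>The 1 in the denominator covers \<open>x0 = 0\<close>.\<close>
      define q where "q = e / (2 * (norm x0 + 1))"
      have pos: "0 < norm x0 + 1" by (simp add: add_nonneg_pos)
      have q: "0 < q" "q * norm x0 \<le> e / 2"
        using e pos by (auto simp: q_def field_simps)
      obtain x where x: "norm x \<le> 1" "1 - q\<^sup>2 / 2 < re (\<phi> x)" "norm x0 + 1 - e / 2 \<le> norm (x0 + x)"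
        using pts[OF \<phi>, of "q\<^sup>2 / 2" "e / 2" x0] e q(1) by (auto simp: cap_def)
      have "norm (\<phi> x) \<le> 1" using functional_norm_le[OF \<phi>, of x] x(1) by linarith
      then have close: "norm (1 - \<phi> x) \<le> q" using x(2) less_imp_le[OF q(1)] by (rule norm_one_minus_le)
      have "x0 + x = (x + T x) + scale (1 - \<phi> x) x0" by (simp add: T\<phi> scale_left_diff_distrib)
      then have "norm (x0 + x) \<le> norm (x + T x) + norm (1 - \<phi> x) * norm x0"
        by (metis norm_triangle_ineq norm_scale)
      moreover have "norm (1 - \<phi> x) * norm x0 \<le> e / 2"
        using mult_right_mono[OF close, of "norm x0"] q(2) by simp
      moreover have "norm (x + T x) \<le> onorm (\<lambda>x. x + T x)"
        using onorm[OF IT, of x] mult_left_mono[OF x(1) onorm_pos_le[OF IT]] by simp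
      ultimately show ?thesis using x(3) by linarith
    qed
    then have "1 + norm x0 \<le> onorm (\<lambda>x. x + T x)" by (rule field_le_epsilon)
    with T_norm show "1 + onorm T \<le> onorm (\<lambda>x. x + T x)" by linarith
  qed
qed

lemma (in banach_over) slice_contains_normalized_slice:
  assumes "slice_of scale (cball 0 1) S"
  shows "\<exists>\<psi> d. bounded_linear_over scale ((*) :: 'k \<Rightarrow> 'k \<Rightarrow> 'k) \<psi> \<and> onorm \<psi> = 1 \<and> d < 1 \<and>
    cap (\<lambda>y. re (\<psi> y)) d \<subseteq> S"
proof -
  obtain f d where ne: "S \<noteq> {}" and f: "bounded_linear_over scale ((*) :: 'k \<Rightarrow> 'k \<Rightarrow> 'k) f"
    and S: "S = {x \<in> cball 0 1. re (f x) > (SUP a\<in>cball 0 1. re (f a)) - d}"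
    using assms by (auto simp: slice_of_def)
  have "S = cap (\<lambda>x. re (f x)) ((SUP a\<in>cball 0 1. re (f a)) - d)"
    by (auto simp: S cap_def)
  then show ?thesis
    using cap_contains_normalized_slice[OF bounded_linear_re_functional[OF f]] ne by simp
qed

section \<open>Tensors in prescribed slices\<close>

context projective_tensor
begin

text \<open>
  The tensor product of \<open>\<phi>\<close> and \<open>\<psi>\<close> defines a cap of the ball of the projective tensor product.
  By the Daugavet property it contains a smaller cap all of whose points are norming for \<open>K\<close>, and
  that one contains a simple tensor. Since \<open>\<phi> x * \<psi> y\<close> is almost 1, so are both moduli. A
  unimodular scalar, moved from one factor to the other, makes \<open>\<psi> y\<close> and hence almost
  \<open>\<phi> x\<close> real and positive without changing the tensor.
\<close>

lemma norming_tensor_in_slices: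
  fixes K :: "'z set"
  assumes D: "Daugavet_property r" and K: "compact K" and e: "0 < e"
    and \<phi>: "bounded_linear_over s ((*) :: 'k \<Rightarrow> 'k \<Rightarrow> 'k) \<phi>" "onorm \<phi> = 1" and c: "c < 1"
    and \<psi>: "bounded_linear_over t ((*) :: 'k \<Rightarrow> 'k \<Rightarrow> 'k) \<psi>" "onorm \<psi> = 1" and d: "d < 1"
  shows "\<exists>x\<in>cap (\<lambda>x. re (\<phi> x)) c. \<exists>y\<in>cap (\<lambda>y. re (\<psi> y)) d.
    \<forall>k\<in>K. norm k + 1 - e \<le> norm (k + tensor x y)"
proof -
  note \<phi>le = X.functional_norm_le[OF \<phi>] and \<psi>le = Y.functional_norm_le[OF \<psi>]
  obtain h where h: "bounded_linear h" "\<And>z. h z \<le> norm z" "\<And>x y. h (tensor x y) = re (\<phi> x * \<psi> y)"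
    using tensor_of_functionals[OF \<phi>(1) \<phi>le \<psi>(1) \<psi>le] by blast
  \<comment> \<open>With a nonnegative height, both factors of the product are positive and exceed it.\<close>
  define m where "m = max 0 (max c d)"
  have m: "0 \<le> m" "m < 1" "c \<le> m" "d \<le> m" using c d by (auto simp: m_def)
  have "cap h m \<noteq> {}"
  proof -
    \<comment> \<open>Two factors above \<open>sqrt q\<close> have a product above \<open>q\<close>, which exceeds \<open>m\<close>.\<close>
    define q where "q = (1 + m) / 2"
    have q: "0 \<le> q" "q < 1" "m < q" "0 < q" using m by (auto simp: q_def)
    have "sqrt q < 1" "0 \<le> sqrt q" using q by auto
    then obtain x y where x: "norm x \<le> 1" "sqrt q < norm (\<phi> x)" and y: "norm y \<le> 1" "sqrt q < norm (\<psi> y)"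
      using onorm_point[OF X.functional_bounded_linear[OF \<phi>(1)]]
        onorm_point[OF Y.functional_bounded_linear[OF \<psi>(1)]] \<phi>(2) \<psi>(2) by metis
    obtain u :: 'k where u: "norm u = 1" "u * (\<phi> x * \<psi> y) = of_real (norm (\<phi> x * \<psi> y))"
      using unimodular_rotation by blast
    have "h (tensor (s u x) y) = norm (\<phi> x) * norm (\<psi> y)"
      using u(2) by (simp only: h(3) X.functional_scale[OF \<phi>(1)] mult.assoc re_of_real norm_mult)
    moreover have "sqrt q * sqrt q \<le> norm (\<phi> x) * norm (\<psi> y)"
      using x(2) y(2) q by (intro mult_mono) auto
    moreover have "norm (tensor (s u x) y) \<le> 1"
      using x(1) y(1) by (simp add: norm_tensor X.norm_scale u(1) mult_le_one)
    ultimately have "tensor (s u x) y \<in> cap h m" using q by (simp add: cap_def)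
    then show ?thesis by blast
  qed
  then obtain h' c' where h': "bounded_linear h'" "cap h' c' \<noteq> {}" "cap h' c' \<subseteq> cap h m"
    "\<And>k w. k \<in> K \<Longrightarrow> w \<in> cap h' c' \<Longrightarrow> norm k + 1 - e \<le> norm (k + w)"
    using Z.Daugavet_subcap_compact[OF D e K h(1)] by blast
  obtain x y where xy: "norm x \<le> 1" "norm y \<le> 1" "c' < h' (tensor x y)"
    using cap_contains_tensor[OF h'(1,2)] by blast
  have "norm (tensor x y) \<le> 1" using xy by (simp add: norm_tensor mult_le_one)
  then have in': "tensor x y \<in> cap h' c'" using xy by (simp add: cap_def)
  then have big: "m < re (\<phi> x * \<psi> y)" using h'(3) by (auto simp: cap_def h(3))
  obtain u :: 'k where u: "norm u = 1" "u * \<psi> y = of_real (norm (\<psi> y))"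
    using unimodular_rotation by blast
  have u0: "u \<noteq> 0" using u(1) by auto
  let ?x = "s (inverse u) x" and ?y = "t u y"
  have same: "tensor ?x ?y = tensor x y"
    using u0 by (simp add: tensor_scale_left tensor_scale_right)
  have norms: "norm ?x \<le> 1" "norm ?y \<le> 1"
    using xy u(1) by (simp_all add: X.norm_scale Y.norm_scale norm_inverse)
  have \<psi>y: "\<psi> ?y = of_real (norm (\<psi> y))" using u(2) by (simp add: Y.functional_scale[OF \<psi>(1)])
  have le1: "norm (\<psi> y) \<le> 1" "norm (\<phi> x) \<le> 1"
    using \<phi>le[of x] \<psi>le[of y] xy by linarith+
  have "m < norm (\<phi> x) * norm (\<psi> y)"
    using big re_le_norm[of "\<phi> x * \<psi> y"] by (simp add: norm_mult)
  also have "\<dots> \<le> norm (\<psi> y)" using le1 by (simp add: mult_left_le_one_le)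
  finally have y: "m < re (\<psi> ?y)" by (simp add: \<psi>y re_of_real)
  have "\<phi> ?x * \<psi> ?y = \<phi> x * \<psi> y"
    using u0 by (simp add: X.functional_scale[OF \<phi>(1)] Y.functional_scale[OF \<psi>(1)])
  then have "re (\<phi> ?x * of_real (norm (\<psi> y))) = re (\<phi> x * \<psi> y)" by (simp only: \<psi>y)
  then have prod: "m < re (\<phi> ?x) * norm (\<psi> y)" using big by (simp only: re_mult_of_real)
  then have "0 < re (\<phi> ?x) * norm (\<psi> y)" using m(1) by linarith
  then have "0 < re (\<phi> ?x)" by (simp add: zero_less_mult_iff)
  then have "re (\<phi> ?x) * norm (\<psi> y) \<le> re (\<phi> ?x)" using le1(1) by (simp add: mult_left_le)
  with prod have "m < re (\<phi> ?x)" by linarith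
  with y m norms have "?x \<in> cap (\<lambda>x. re (\<phi> x)) c" "?y \<in> cap (\<lambda>y. re (\<psi> y)) d"
    by (auto simp: cap_def)
  moreover have "\<forall>k\<in>K. norm k + 1 - e \<le> norm (k + tensor ?x ?y)"
    using h'(4) in' by (simp add: same)
  ultimately show ?thesis by blast
qed

text \<open>
  The inductive step of the construction. A point of the new hull is \<open>(1 - a) *\<^sub>R v + a *\<^sub>R z\<close> with
  \<open>v\<close> old and \<open>z\<close> the new tensor. Choosing \<open>z\<close> norming for the compact set of all vectors
  \<open>z0 + (1 - a) *\<^sub>R v\<close> costs only \<open>e\<close> in norm, and the loss from shortening \<open>v\<close> is made up by the
  length of the new summand. The empty set is admitted as the start of the induction.
\<close>

lemma norming_convex_set_step:
  fixes C :: "'z set"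
  assumes D: "Daugavet_property r" and e: "0 < e"
    and \<phi>: "bounded_linear_over s ((*) :: 'k \<Rightarrow> 'k \<Rightarrow> 'k) \<phi>" "onorm \<phi> = 1" and c: "c < 1"
    and \<psi>: "bounded_linear_over t ((*) :: 'k \<Rightarrow> 'k \<Rightarrow> 'k) \<psi>" "onorm \<psi> = 1" and d: "d < 1"
    and C: "compact C" "convex C" "C \<subseteq> cball 0 1"
    and C_norming: "\<And>w. w \<in> C \<Longrightarrow> norm z0 + 1 - p \<le> norm (z0 + w)" and p: "0 \<le> p"
  shows "\<exists>x\<in>cap (\<lambda>x. re (\<phi> x)) c. \<exists>y\<in>cap (\<lambda>y. re (\<psi> y)) d. \<exists>C'.
    tensor x y \<in> C' \<and> C \<subseteq> C' \<and> compact C' \<and> convex C' \<and> C' \<subseteq> cball 0 1 \<and>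
    (\<forall>w\<in>C'. norm z0 + 1 - (p + e) \<le> norm (z0 + w))"
proof -
  define K where "K = insert z0 ((\<lambda>(a, w). z0 + (1 - a) *\<^sub>R w) ` ({0..1} \<times> C))"
  have "compact ((\<lambda>(a, w). z0 + (1 - a) *\<^sub>R w) ` ({0..1::real} \<times> C))"
    unfolding case_prod_unfold
    by (intro compact_continuous_image compact_Times C(1) compact_Icc continuous_intros)
  then have "compact K" by (simp add: K_def)
  then obtain x y where x: "x \<in> cap (\<lambda>x. re (\<phi> x)) c" and y: "y \<in> cap (\<lambda>y. re (\<psi> y)) d"
    and K: "\<And>k. k \<in> K \<Longrightarrow> norm k + 1 - e \<le> norm (k + tensor x y)"
    using norming_tensor_in_slices[OF D _ e \<phi> c \<psi> d] by blast
  define z where "z = tensor x y"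
  have z1: "norm z \<le> 1" using x y by (simp add: z_def norm_tensor cap_def mult_le_one)
  define C' where "C' = convex hull (insert z C)"
  have C'_cases: "w = z \<or> (\<exists>a v. 0 \<le> a \<and> a \<le> 1 \<and> v \<in> C \<and> w = (1 - a) *\<^sub>R v + a *\<^sub>R z)" if "w \<in> C'" for w
  proof (cases "C = {}")
    case False
    have "convex hull C = C" using C(2) by (rule hull_same)
    with False that obtain a b v
      where "0 \<le> a" "0 \<le> b" "a + b = 1" "v \<in> C" "w = a *\<^sub>R z + b *\<^sub>R v"
      unfolding C'_def convex_hull_insert[OF False] by auto
    moreover from this have "b = 1 - a" "a \<le> 1" by auto
    ultimately show ?thesis by (metis add.commute)
  qed (use that in \<open>simp add: C'_def\<close>)
  have "compact C'"
  proof -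
    have sub: "insert z C \<subseteq> C'" unfolding C'_def by (rule hull_subset)
    have cv: "convex C'" by (simp add: C'_def convex_convex_hull)
    have "C' = insert z ((\<lambda>(a, v). (1 - a) *\<^sub>R v + a *\<^sub>R z) ` ({0..1} \<times> C))"
    proof (intro equalityI subsetI)
      show "w \<in> insert z ((\<lambda>(a, v). (1 - a) *\<^sub>R v + a *\<^sub>R z) ` ({0..1} \<times> C))" if "w \<in> C'" for w
        using C'_cases[OF that] by force
      show "w \<in> C'" if "w \<in> insert z ((\<lambda>(a, v). (1 - a) *\<^sub>R v + a *\<^sub>R z) ` ({0..1} \<times> C))" for w
        using that sub cv by (auto simp: convex_alt)
    qed
    moreover have "compact ((\<lambda>(a, v). (1 - a) *\<^sub>R v + a *\<^sub>R z) ` ({0..1::real} \<times> C))"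
      unfolding case_prod_unfold
      by (intro compact_continuous_image compact_Times C(1) compact_Icc continuous_intros)
    ultimately show ?thesis by simp
  qed
  moreover have "C' \<subseteq> cball 0 1"
    unfolding C'_def using C(3) z1 by (intro hull_minimal) auto
  moreover have "norm z0 + 1 - (p + e) \<le> norm (z0 + w)" if w: "w \<in> C'" for w
    using C'_cases[OF w]
  proof (elim disjE exE conjE)
    assume "w = z"
    moreover have "norm z0 + 1 - e \<le> norm (z0 + z)" unfolding z_def by (intro K) (simp add: K_def)
    ultimately show ?thesis using p by simp
  next
    fix a v assume a: "0 \<le> a" "a \<le> 1" and v: "v \<in> C" and w: "w = (1 - a) *\<^sub>R v + a *\<^sub>R z"
    let ?k = "z0 + (1 - a) *\<^sub>R v"
    have "?k \<in> K" unfolding K_def using a v by force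
    then have "norm ?k + 1 - e \<le> norm (?k + z)" unfolding z_def by (rule K)
    moreover have "norm (?k + z) \<le> norm (z0 + w) + (1 - a)"
    proof -
      have "?k + z = (z0 + w) + (1 - a) *\<^sub>R z" by (simp add: w algebra_simps)
      then have "norm (?k + z) \<le> norm (z0 + w) + norm ((1 - a) *\<^sub>R z)"
        by (metis norm_triangle_ineq)
      also have "norm ((1 - a) *\<^sub>R z) \<le> 1 - a" using a z1 by (simp add: mult_left_le)
      finally show ?thesis by simp
    qed
    moreover have "norm (z0 + v) \<le> norm ?k + a"
    proof -
      have "z0 + v = ?k + a *\<^sub>R v" by (simp add: algebra_simps)
      then have "norm (z0 + v) \<le> norm ?k + norm (a *\<^sub>R v)" by (metis norm_triangle_ineq)
      also have "norm (a *\<^sub>R v) \<le> a" using a v C(3) by (auto simp: mult_left_le)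
      finally show ?thesis by simp
    qed
    ultimately show ?thesis using C_norming[OF v] by linarith
  qed
  moreover have "z \<in> C'" "C \<subseteq> C'" "convex C'"
    by (auto simp: C'_def hull_inc convex_convex_hull)
  ultimately show ?thesis using x y unfolding z_def by blast
qed

text \<open>
  Iterating the step over all slices \<open>V n\<close> with geometrically decreasing losses yields an increasing
  sequence of convex sets whose union contains all convex combinations of the chosen tensors. The
  sum of the losses stays below \<open>e\<close>.
\<close>

lemma norming_sequence:
  assumes D: "Daugavet_property r" and e: "0 < e"
    and \<phi>: "bounded_linear_over s ((*) :: 'k \<Rightarrow> 'k \<Rightarrow> 'k) \<phi>" "onorm \<phi> = 1" and c: "c < 1"
    and V: "\<And>n. slice_of t (cball 0 1) (V n)"
  shows "\<exists>x y. (\<forall>n::nat. x n \<in> cap (\<lambda>x. re (\<phi> x)) c \<and> y n \<in> V n) \<and>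
    (\<forall>w \<in> convex hull (range (\<lambda>n. tensor (x n) (y n))). norm z0 + 1 - e \<le> norm (z0 + w))"
proof -
  have "\<exists>\<psi> d. bounded_linear_over t ((*) :: 'k \<Rightarrow> 'k \<Rightarrow> 'k) \<psi> \<and> onorm \<psi> = 1 \<and> d < 1 \<and>
    cap (\<lambda>y. re (\<psi> y)) d \<subseteq> V n" for n
    by (rule Y.slice_contains_normalized_slice[OF V])
  then obtain \<psi> d where \<psi>: "\<And>n. bounded_linear_over t ((*) :: 'k \<Rightarrow> 'k \<Rightarrow> 'k) (\<psi> n)"
    "\<And>n. onorm (\<psi> n) = 1" and d: "\<And>n. d n < 1" "\<And>n. cap (\<lambda>y. re (\<psi> n y)) (d n) \<subseteq> V n"
    by metis
  \<comment> \<open>The loss accumulated in the first \<open>n\<close> steps.\<close>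
  define p where "p n = e * (1 - (1 / 2) ^ n)" for n :: nat
  have p: "0 \<le> p n" "p n \<le> e" "p (Suc n) = p n + e * (1 / 2) ^ Suc n" for n
    using e by (auto simp: p_def power_le_one algebra_simps)
  define P where "P n \<sigma> \<longleftrightarrow> (case \<sigma> of (x, y, C) \<Rightarrow> x \<in> cap (\<lambda>x. re (\<phi> x)) c \<and> y \<in> V n \<and>
    tensor x y \<in> C \<and> compact C \<and> convex C \<and> C \<subseteq> cball 0 1 \<and>
    (\<forall>w\<in>C. norm z0 + 1 - p (Suc n) \<le> norm (z0 + w)))" for n and \<sigma> :: "'x \<times> 'y \<times> 'z set"
  have step: "\<exists>\<sigma>. P n \<sigma> \<and> C \<subseteq> snd (snd \<sigma>)"
    if C: "compact C" "convex C" "C \<subseteq> cball 0 1" "\<And>w. w \<in> C \<Longrightarrow> norm z0 + 1 - p n \<le> norm (z0 + w)"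
    for n C
  proof -
    have pos: "0 < e * (1 / 2) ^ Suc n" using e by simp
    obtain x y C' where "x \<in> cap (\<lambda>x. re (\<phi> x)) c" "y \<in> cap (\<lambda>y. re (\<psi> n y)) (d n)"
      "tensor x y \<in> C'" "C \<subseteq> C'" "compact C'" "convex C'" "C' \<subseteq> cball 0 1"
      "\<forall>w\<in>C'. norm z0 + 1 - (p n + e * (1 / 2) ^ Suc n) \<le> norm (z0 + w)"
      using norming_convex_set_step[OF D pos \<phi> c \<psi>(1,2) d(1) C(1-3), of z0 "p n" n] C(4) p(1)
      by blast
    then show ?thesis
      using d(2)[of n] by (intro exI[of _ "(x, y, C')"]) (auto simp: P_def p(3))
  qed
  have "\<exists>\<sigma>. \<forall>n. P n (\<sigma> n) \<and> snd (snd (\<sigma> n)) \<subseteq> snd (snd (\<sigma> (Suc n)))"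
  proof (rule dependent_nat_choice)
    show "\<exists>\<sigma>. P 0 \<sigma>" using step[of "{}" 0] by auto
    show "\<exists>\<sigma>'. P (Suc n) \<sigma>' \<and> snd (snd \<sigma>) \<subseteq> snd (snd \<sigma>')" if "P n \<sigma>" for \<sigma> n
      using that by (intro step) (auto simp: P_def)
  qed
  then obtain \<sigma> where \<sigma>: "\<And>n. P n (\<sigma> n)" "\<And>n. snd (snd (\<sigma> n)) \<subseteq> snd (snd (\<sigma> (Suc n)))" by blast
  define x y C where "x n = fst (\<sigma> n)" and "y n = fst (snd (\<sigma> n))" and "C n = snd (snd (\<sigma> n))" for n
  have PC: "x n \<in> cap (\<lambda>x. re (\<phi> x)) c" "y n \<in> V n" "tensor (x n) (y n) \<in> C n" "convex (C n)"
    "\<And>w. w \<in> C n \<Longrightarrow> norm z0 + 1 - p (Suc n) \<le> norm (z0 + w)" for n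
    using \<sigma>(1)[of n] by (auto simp: P_def x_def y_def C_def split: prod.splits)
  have mono: "C m \<subseteq> C n" if "m \<le> n" for m n
    using lift_Suc_mono_le[of C, OF _ that] \<sigma>(2) by (simp add: C_def)
  have "convex (\<Union>n. C n)"
  proof (rule convexI)
    fix v w and a b :: real
    assume vw: "v \<in> (\<Union>n. C n)" "w \<in> (\<Union>n. C n)" and ab: "0 \<le> a" "0 \<le> b" "a + b = 1"
    then obtain m n where "v \<in> C m" "w \<in> C n" by blast
    then have "v \<in> C (max m n)" "w \<in> C (max m n)" using mono by (meson max.cobounded1 max.cobounded2 subsetD)+
    then have "a *\<^sub>R v + b *\<^sub>R w \<in> C (max m n)" using PC(4) ab by (auto simp: convex_def)
    then show "a *\<^sub>R v + b *\<^sub>R w \<in> (\<Union>n. C n)" by blast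
  qed
  have "convex hull (range (\<lambda>n. tensor (x n) (y n))) \<subseteq> (\<Union>n. C n)"
    using PC(3) by (intro hull_minimal \<open>convex (\<Union>n. C n)\<close>) auto
  moreover have "norm z0 + 1 - e \<le> norm (z0 + w)" if "w \<in> (\<Union>n. C n)" for w
  proof -
    obtain n where "w \<in> C n" using \<open>w \<in> (\<Union>n. C n)\<close> by blast
    then show ?thesis using PC(5) p(2)[of "Suc n"] by fastforce
  qed
  ultimately show ?thesis using PC(1,2) by (intro exI[of _ x] exI[of _ y]) blast
qed

text \<open>
  Suppose that every \<open>x\<close> in the slice had \<open>norm (x0 + x)\<close> at most \<open>norm x0 + 1 - e\<close>. The
  chosen \<open>y n\<close> meet all determining slices, so \<open>y0\<close> is almost a convex combination of them. Taking
  the hull of the pairs of \<open>y n\<close> and \<open>x n \<otimes> y n\<close> attaches to it the combination \<open>z'\<close> of the tensors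
  with the same weights, without naming the weights. Then \<open>x0 \<otimes> y0 + z'\<close> is close to a
  convex combination of the tensors \<open>(x0 + x n) \<otimes> y n\<close>, hence short, although the choice of the
  tensors makes it long.
\<close>

lemma Daugavet_slice_point:
  assumes D: "Daugavet_property r" and SCD: "slicely_countably_determined t (cball 0 1)"
    and \<phi>: "bounded_linear_over s ((*) :: 'k \<Rightarrow> 'k \<Rightarrow> 'k) \<phi>" "onorm \<phi> = 1" and c: "c < 1" and e: "0 < e"
  shows "\<exists>x\<in>cap (\<lambda>x. re (\<phi> x)) c. norm x0 + 1 - e \<le> norm (x0 + x)"
proof (rule ccontr)
  assume "\<not> ?thesis"
  then have small: "norm (x0 + x) \<le> norm x0 + 1 - e" if "x \<in> cap (\<lambda>x. re (\<phi> x)) c" for x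
    using that by force
  obtain V where V: "\<And>n. slice_of t (cball 0 1) (V n)" and det: "determining (cball 0 1) V"
    using SCD by (auto simp: slicely_countably_determined_def)
  obtain v :: 'y where "v \<noteq> 0" using Y.nonzero by blast
  define y0 where "y0 = (1 / norm v) *\<^sub>R v"
  have y0: "norm y0 = 1" using \<open>v \<noteq> 0\<close> by (simp add: y0_def)
  define z0 where "z0 = tensor x0 y0"
  have z0: "norm z0 = norm x0" by (simp add: z0_def norm_tensor y0)
  obtain x y where xy: "\<forall>n::nat. x n \<in> cap (\<lambda>x. re (\<phi> x)) c \<and> y n \<in> V n"
    and norming: "\<forall>w \<in> convex hull (range (\<lambda>n. tensor (x n) (y n))).
      norm z0 + 1 - e / 2 \<le> norm (z0 + w)"
    using norming_sequence[where V = V and ?z0.0 = z0, OF D half_gt_zero[OF e] \<phi> c V] by (elim exE conjE)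
  then have x: "x n \<in> cap (\<lambda>x. re (\<phi> x)) c" and y: "y n \<in> V n" for n by simp_all
  have ball: "y n \<in> cball 0 1" for n using det y unfolding determining_def by blast
  have "cball 0 1 \<subseteq> closure (convex hull (range y))"
    using det ball y unfolding determining_def by (metis disjoint_iff image_subset_iff rangeI)
  then have "y0 \<in> closure (convex hull (range y))" using y0 by auto
  moreover have pos: "0 < 2 * (norm x0 + 1)" by (simp add: add_nonneg_pos)
  then have "0 < e / (2 * (norm x0 + 1))" using e by simp
  ultimately obtain y' where y': "y' \<in> convex hull (range y)" "dist y' y0 < e / (2 * (norm x0 + 1))"
    unfolding closure_approachable by blast
  define W where "W = convex hull (range (\<lambda>n. (y n, tensor (x n) (y n))))"
  have "fst ` W = convex hull (range y)"
    by (simp add: W_def convex_hull_linear_image[OF linear_fst] image_image)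
  then obtain z' where W: "(y', z') \<in> W" using y'(1) by force
  have "snd ` W = convex hull (range (\<lambda>n. tensor (x n) (y n)))"
    by (simp add: W_def convex_hull_linear_image[OF linear_snd] image_image)
  then have "z' \<in> convex hull (range (\<lambda>n. tensor (x n) (y n)))" using W by force
  then have "norm z0 + 1 - e / 2 \<le> norm (z0 + z')" by (rule norming[rule_format])
  then have lower: "norm x0 + 1 - e / 2 \<le> norm (z0 + z')" by (simp add: z0)
  \<comment> \<open>On pairs, the estimate to be averaged is membership in the preimage of a ball.\<close>
  define L where "L = (\<lambda>(v, w). tensor x0 v + w)"
  have "linear L"
    by (rule linearI) (auto simp: L_def linear_add[OF linear_tensor_right]
        linear_cmul[OF linear_tensor_right] scaleR_add_right)
  then have "convex (L -` cball 0 (norm x0 + 1 - e))"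
    by (intro convex_linear_vimage convex_cball)
  moreover have "(y n, tensor (x n) (y n)) \<in> L -` cball 0 (norm x0 + 1 - e)" for n
  proof -
    have "norm (L (y n, tensor (x n) (y n))) = norm (x0 + x n) * norm (y n)"
      by (simp add: L_def norm_tensor flip: tensor_add_left)
    also have "\<dots> \<le> norm (x0 + x n)" using ball[of n] by (simp add: mult_left_le)
    finally show ?thesis using small[OF x, of n] by simp
  qed
  ultimately have "W \<subseteq> L -` cball 0 (norm x0 + 1 - e)"
    unfolding W_def by (intro hull_minimal) auto
  then have upper: "norm (tensor x0 y' + z') \<le> norm x0 + 1 - e" using W by (auto simp: L_def)
  have "z0 + z' = (tensor x0 y' + z') + tensor x0 (y0 - y')"
    by (simp add: z0_def linear_diff[OF linear_tensor_right])
  then have "norm (z0 + z') \<le> norm (tensor x0 y' + z') + norm x0 * norm (y0 - y')"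
    by (metis norm_triangle_ineq norm_tensor)
  moreover have "norm x0 * norm (y0 - y') < e / 2"
  proof -
    have "norm x0 * norm (y0 - y') \<le> (norm x0 + 1) * norm (y0 - y')"
      by (intro mult_right_mono) auto
    also have "\<dots> < e / 2"
    proof -
      have "norm (y0 - y') * (2 * (norm x0 + 1)) < e"
        using y'(2) pos_less_divide_eq[OF pos] by (simp add: dist_norm norm_minus_commute)
      then show ?thesis by (simp add: algebra_simps)
    qed
    finally show ?thesis .
  qed
  ultimately show False using lower upper by linarith
qed

end

theorem theorem4p1:
  fixes scaleX :: "'k::real_or_complex \<Rightarrow> 'x::banach \<Rightarrow> 'x"
    and scaleY :: "'k \<Rightarrow> 'y::banach \<Rightarrow> 'y"
    and scaleZ :: "'k \<Rightarrow> 'z::banach \<Rightarrow> 'z"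
    and \<iota> :: "(('x \<Rightarrow> 'y \<Rightarrow> 'k) \<Rightarrow> 'k) \<Rightarrow> 'z"
  assumes "banach_over scaleX"
    and "banach_over scaleY"
    and "projective_tensor_product scaleX scaleY scaleZ \<iota>"
    and "slicely_countably_determined scaleY (cball 0 1)"
    and "Daugavet_property scaleZ"
  shows "Daugavet_property scaleX"
proof -
  interpret projective_tensor scaleX scaleY scaleZ \<iota>
    using assms(1-3) by (simp add: projective_tensor_def projective_tensor_axioms_def)
  show ?thesis
    by (rule X.Daugavet_property_if_slice_points) (rule Daugavet_slice_point[OF assms(5,4)]; simp)
qed

end
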